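(* Let $\Gamma_1$ and $\Gamma_2$ be metrized graphs, and let $\Gamma_1\cup\Gamma_2$ be their union along two distinct points $p,q$, so that $\Gamma_1\cap\Gamma_2=\{p,q\}$. Let $r_1,r_2$ be the resistance functions on $\Gamma_1,\Gamma_2$. Then $$A_{p,q,\Gamma_1\cup\Gamma_2}=\frac{r_2(p,q)^2A_{p,q,\Gamma_1}+r_1(p,q)^2A_{p,q,\Gamma_2}}{\big(r_1(p,q)+r_2(p,q)\big)^2}+\frac16\Big(\frac{r_1(p,q)\,r_2(p,q)}{r_1(p,q)+r_2(p,q)}\Big)^2.$$
   Context: A metrized graph is a finite connected graph (multiple edges and self-loops allowed) in which each edge is identified with a closed interval of positive length. Regard it as a resistive circuit with segment resistance equal to length; $r(x,y)$ is effective resistance, and $j_z(x,y)$ is the potential at $x$ when unit current enters at $y$ and exits at $z$, with potential $0$ at $z$. For a metrized graph $G$ and $p,q\in G$, $A_{p,q,G}=\int_G j_x(p,q)\big(\frac{d}{dx}j_p(x,q)\big)^2dx$, using the voltage function of $G$ ($dx$ arclength, $d/dx$ along edges). *)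

theory Defs
  imports "HOL-Analysis.Analysis"
begin

text \<open>
  The points of a metrized graph live in an ambient type \<open>'a\<close>. An edge is a pair \<open>(L, \<gamma>)\<close> of its
  length and its arclength parametrization; only the values of \<open>\<gamma>\<close> on \<open>{0..L}\<close> are meaningful.
  Self-loops are edges with \<open>\<gamma> 0 = \<gamma> L\<close>, and parallel edges are told apart by their interior points.
\<close>

record 'a mgraph =
  verts :: "'a set"
  edges :: "(real \<times> (real \<Rightarrow> 'a)) set"

definition edge_interior :: "real \<times> (real \<Rightarrow> 'a) \<Rightarrow> 'a set" where
  "edge_interior e = snd e ` {0<..<fst e}"

definition edge_ends :: "'a mgraph \<Rightarrow> ('a \<times> 'a) set" where
  "edge_ends G = {(\<gamma> 0, \<gamma> L) | L \<gamma>. (L, \<gamma>) \<in> edges G}"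

locale metrized_graph =
  fixes G :: "'a mgraph"
  assumes finite_verts: "finite (verts G)"
    and finite_edges: "finite (edges G)"
    and verts_nonempty: "verts G \<noteq> {}"
    and length_pos: "(L, \<gamma>) \<in> edges G \<Longrightarrow> 0 < L"
    and start_in_verts: "(L, \<gamma>) \<in> edges G \<Longrightarrow> \<gamma> 0 \<in> verts G"
    and end_in_verts: "(L, \<gamma>) \<in> edges G \<Longrightarrow> \<gamma> L \<in> verts G"
    and edge_inj: "(L, \<gamma>) \<in> edges G \<Longrightarrow> inj_on \<gamma> {0<..<L}"
    and interior_verts: "e \<in> edges G \<Longrightarrow> edge_interior e \<inter> verts G = {}"
    and interior_disjoint: "e \<in> edges G \<Longrightarrow> e' \<in> edges G \<Longrightarrow> e \<noteq> e' \<Longrightarrow>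
      edge_interior e \<inter> edge_interior e' = {}"
    and connected: "u \<in> verts G \<Longrightarrow> v \<in> verts G \<Longrightarrow> (u, v) \<in> (edge_ends G \<union> (edge_ends G)\<inverse>)\<^sup>*"

definition points :: "'a mgraph \<Rightarrow> 'a set" where
  "points G = verts G \<union> (\<Union>e\<in>edges G. edge_interior e)"

text \<open>
  Subdivision at the points of \<open>S\<close> (meant for finite \<open>S \<subseteq> points G\<close>): every edge is cut at the parameters
  where it meets \<open>S\<close>. Edges not meeting \<open>S\<close> in their interior are kept (take \<open>a = 0\<close>, \<open>b = L\<close>).
\<close>

definition subdivide :: "'a mgraph \<Rightarrow> 'a set \<Rightarrow> 'a mgraph" where
  "subdivide G S = \<lparr>
     verts = verts G \<union> S,
     edges = {(b - a, \<lambda>t. \<gamma> (a + t)) | L \<gamma> a b.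
       (L, \<gamma>) \<in> edges G \<and> 0 \<le> a \<and> a < b \<and> b \<le> L \<and>
       \<gamma> a \<in> verts G \<union> S \<and> \<gamma> b \<in> verts G \<union> S \<and>
       (\<forall>t\<in>{a<..<b}. \<gamma> t \<notin> verts G \<union> S)}\<rparr>"

text \<open>
  The union along the common points. These need not be vertices of \<open>G1\<close> or \<open>G2\<close>, so both graphs are
  first subdivided there.
\<close>

definition mg_union :: "'a mgraph \<Rightarrow> 'a mgraph \<Rightarrow> 'a mgraph" where
  "mg_union G1 G2 =
     (let S = points G1 \<inter> points G2 in
      \<lparr>verts = verts (subdivide G1 S) \<union> verts (subdivide G2 S),
       edges = edges (subdivide G1 S) \<union> edges (subdivide G2 S)\<rparr>)"

text \<open>
  Net current leaving \<open>v\<close> through the incident edges, by Ohm's law. The two sums run over the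
  edges starting and ending at \<open>v\<close>; a self-loop occurs in both and contributes \<open>0\<close>.
\<close>

definition outflow :: "'a mgraph \<Rightarrow> ('a \<Rightarrow> real) \<Rightarrow> 'a \<Rightarrow> real" where
  "outflow G f v =
     (\<Sum>(L, \<gamma>)\<in>{(L, \<gamma>) \<in> edges G. \<gamma> 0 = v}. (f (\<gamma> 0) - f (\<gamma> L)) / L) +
     (\<Sum>(L, \<gamma>)\<in>{(L, \<gamma>) \<in> edges G. \<gamma> L = v}. (f (\<gamma> L) - f (\<gamma> 0)) / L)"

text \<open>
  \<open>f\<close> is the electric potential on \<open>G\<close> when unit current enters at \<open>y\<close> and exits at \<open>z\<close>, grounded at \<open>z\<close>:
  after making \<open>y\<close> and \<open>z\<close> vertices, \<open>f\<close> is affine along edges and satisfies Kirchhoff's current law.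
\<close>

definition is_potential :: "'a mgraph \<Rightarrow> 'a \<Rightarrow> 'a \<Rightarrow> ('a \<Rightarrow> real) \<Rightarrow> bool" where
  "is_potential G y z f \<longleftrightarrow>
     (\<forall>(L, \<gamma>)\<in>edges (subdivide G {y, z}). \<forall>t\<in>{0..L}.
        f (\<gamma> t) = f (\<gamma> 0) + t / L * (f (\<gamma> L) - f (\<gamma> 0))) \<and>
     (\<forall>v\<in>verts (subdivide G {y, z}).
        outflow (subdivide G {y, z}) f v = of_bool (v = y) - of_bool (v = z)) \<and>
     f z = 0"

text \<open>
  \<open>voltage G z x y\<close> is $j_z(x,y)$. For points of a metrized graph the potential exists and is unique
  on \<open>points G\<close>.
\<close>

definition voltage :: "'a mgraph \<Rightarrow> 'a \<Rightarrow> 'a \<Rightarrow> 'a \<Rightarrow> real" where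
  "voltage G z x y = (SOME f. is_potential G y z f) x"

text \<open>
  The potential drop from \<open>x\<close> to \<open>y\<close> under unit current, the potential at \<open>y\<close> being \<open>0\<close>.
\<close>

definition eff_resistance :: "'a mgraph \<Rightarrow> 'a \<Rightarrow> 'a \<Rightarrow> real" where
  "eff_resistance G x y = voltage G y x x"

text \<open>
  The derivative exists at all but finitely many parameters of each edge; the remaining ones
  do not affect the integral.
\<close>

definition A_const :: "'a mgraph \<Rightarrow> 'a \<Rightarrow> 'a \<Rightarrow> real" where
  "A_const G p q =
     (\<Sum>(L, \<gamma>)\<in>edges G.
        integral {0..L} (\<lambda>t. voltage G (\<gamma> t) p q * (deriv (\<lambda>s. voltage G p (\<gamma> s) q) t)\<^sup>2))"

end

theory Submission
  imports Defs
begin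

text \<open>
  Kirchhoff's law is the weak equation \<open>E(f, g) = g y - g z\<close> for all test functions \<open>g\<close>, where \<open>E\<close> is
  the Dirichlet form. As \<open>f\<close> is affine on edges, \<open>E(f, g)\<close> does not change under subdivision, so all
  points involved may be taken to be vertices. On the union \<open>E\<close> is the sum of the Dirichlet forms of the two
  parts. Write \<open>f\<^sub>i = j\<^sub>p(\<cdot>, q)\<close> on the \<open>i\<close>-th graph. Testing the potentials of the union against potentials
  of the parts shows that for \<open>x\<close> in the first graph the potential \<open>j\<^sub>p(x, q)\<close> of the union is
  \<open>r\<^sub>2 / (r\<^sub>1 + r\<^sub>2) \<cdot> f\<^sub>1(x)\<close>, and that \<open>j\<^sub>x(p, q)\<close> increases by
  \<open>f\<^sub>1(x) (r\<^sub>1 - f\<^sub>1(x)) / (r\<^sub>1 + r\<^sub>2)\<close> on passing from the first graph to the union. The integral of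
  \<open>f\<^sub>1 (r\<^sub>1 - f\<^sub>1) f\<^sub>1'\<^sup>2\<close> is \<open>E(f\<^sub>1, \<Phi> \<circ> f\<^sub>1) = \<Phi>(r\<^sub>1) - \<Phi>(0) = r\<^sub>1\<^sup>3 / 6\<close> with \<open>\<Phi>' s = s (r\<^sub>1 - s)\<close>.
\<close>

section \<open>Subdivision\<close>

definition consecutive :: "real set \<Rightarrow> (real \<times> real) set" where
  "consecutive C = {(a, b). a \<in> C \<and> b \<in> C \<and> a < b \<and> (\<forall>t\<in>C. \<not> (a < t \<and> t < b))}"

text \<open>The step for inductions in increasing order: a new maximum opens exactly one gap and
  splits none of the old ones.\<close>

lemma consecutive_insert_max:
  assumes "finite C" "C \<noteq> {}" "\<And>t. t \<in> C \<Longrightarrow> t < m"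
  shows "consecutive (insert m C) = insert (Max C, m) (consecutive C)"
proof -
  have M: "Max C \<in> C" "\<And>t. t \<in> C \<Longrightarrow> t \<le> Max C" using assms by auto
  have m: "m \<notin> C" using assms(3) by auto
  have "(a, b) \<in> consecutive (insert m C) \<longleftrightarrow> (a, b) \<in> insert (Max C, m) (consecutive C)" for a b
  proof (cases "b = m")
    case True
    have "(\<forall>t\<in>C. \<not> (a < t \<and> t < m)) \<longleftrightarrow> a = Max C" if "a \<in> C"
      using M that assms(3) by (metis linorder_not_less order_le_less)
    then show ?thesis using True M(1) m assms(3) by (auto simp: consecutive_def)
  next
    case False
    have "\<not> t < b" if "t = m" "b \<in> C" for t using that assms(3)[of b] by simp
    then show ?thesis using False assms(3) by (auto simp: consecutive_def)
  qed
  then show ?thesis by (intro set_eqI) (metis surj_pair)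
qed

lemma finite_consecutive: "finite C \<Longrightarrow> finite (consecutive C)"
  by (rule finite_subset[of _ "C \<times> C"]) (auto simp: consecutive_def)

lemma consecutive_singleton [simp]: "consecutive {a} = {}"
  by (auto simp: consecutive_def)

text \<open>Induction in increasing order, each new gap adding one more difference. It is what
  leaves the share of an edge in \<open>dirichlet\<close> unchanged when the edge is cut.\<close>

lemma consecutive_telescope:
  fixes h :: "real \<Rightarrow> real"
  assumes "finite C" "C \<noteq> {}"
  shows "(\<Sum>(a, b)\<in>consecutive C. h b - h a) = h (Max C) - h (Min C)"
  using assms
proof (induction C rule: finite_linorder_max_induct)
  case (insert m C)
  show ?case
  proof (cases "C = {}")
    case False
    have "(Max C, m) \<notin> consecutive C"
      using insert by (auto simp: consecutive_def)
    moreover have "Max (insert m C) = m" "Min (insert m C) = Min C"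
      using insert False by (auto intro!: Max_eqI simp: less_imp_le min_def)
         (meson Min_in linorder_not_less order_less_imp_le)
    ultimately show ?thesis
      using insert False by (simp add: consecutive_insert_max finite_consecutive)
  qed simp
qed simp

text \<open>The same induction, now with additivity of the integral over adjacent intervals. It
  reassembles the integral over an edge from those over its pieces.\<close>

lemma consecutive_integral:
  fixes F :: "real \<Rightarrow> real"
  assumes "finite C" "C \<noteq> {}"
    and "\<And>a b. (a, b) \<in> consecutive C \<Longrightarrow> (F has_integral I a b) {a..b}"
  shows "(F has_integral (\<Sum>(a, b)\<in>consecutive C. I a b)) {Min C..Max C}"
  using assms
proof (induction C rule: finite_linorder_max_induct)
  case (insert m C)
  show ?case
  proof (cases "C = {}")
    case True
    then show ?thesis using has_integral_refl(2)[of F m] by (simp add: cbox_interval)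
  next
    case False
    have c: "consecutive (insert m C) = insert (Max C, m) (consecutive C)"
      using insert False by (intro consecutive_insert_max) auto
    have "(Max C, m) \<notin> consecutive C"
      using insert by (auto simp: consecutive_def)
    moreover have mm: "Max (insert m C) = m" "Min (insert m C) = Min C"
      using insert False by (auto intro!: Max_eqI simp: less_imp_le min_def)
         (meson Min_in linorder_not_less order_less_imp_le)
    moreover have "(F has_integral (\<Sum>(a, b)\<in>consecutive C. I a b)) {Min C..Max C}"
      using insert False c by auto
    moreover have "(F has_integral I (Max C) m) {Max C..m}"
      using insert.prems c by auto
    moreover have "Min C \<le> Max C" "Max C \<le> m" using insert False by (auto simp: less_imp_le)
    ultimately show ?thesis
      using has_integral_combine[of "Min C" "Max C" m F "\<Sum>(a, b)\<in>consecutive C. I a b" "I (Max C) m"] c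
        insert.hyps
      by (simp add: finite_consecutive add.commute)
  qed
qed simp

text \<open>If the gaps differed, an end of one would lie strictly inside the other, which contains
  no element of \<open>C\<close>.\<close>

lemma consecutive_overlap:
  assumes "(a, b) \<in> consecutive C" "(a', b') \<in> consecutive C" "a < t" "t < b" "a' < t" "t < b'"
  shows "a = a' \<and> b = b'"
  using assms unfolding consecutive_def
  by simp (metis linorder_cases order_less_trans)

text \<open>The gap runs from the last element of \<open>C\<close> up to \<open>x\<close> to the
  first one from \<open>y\<close> on. It serves to locate the piece of an edge that carries a given
  stretch of parameters.\<close>

lemma consecutive_around:
  assumes "finite C" "c \<in> C" "d \<in> C" "c \<le> x" "y \<le> d" "x < y" "\<forall>t\<in>C. \<not> (x < t \<and> t < y)"
  obtains a b where "(a, b) \<in> consecutive C" "a \<le> x" "y \<le> b"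
proof
  let ?A = "{t\<in>C. t \<le> x}" and ?B = "{t\<in>C. y \<le> t}"
  have "Max ?A \<in> ?A" using assms by (intro Max_in) auto
  then have A: "Max ?A \<in> ?A" "\<And>t. t \<in> ?A \<Longrightarrow> t \<le> Max ?A" using assms by auto
  have "Min ?B \<in> ?B" using assms by (intro Min_in) auto
  then have B: "Min ?B \<in> ?B" "\<And>t. t \<in> ?B \<Longrightarrow> Min ?B \<le> t" using assms by auto
  have "False" if "t \<in> C" "Max ?A < t" "t < Min ?B" for t
    using that A(2)[of t] B(2)[of t] assms(7) by fastforce
  then show "(Max ?A, Min ?B) \<in> consecutive C"
    using A(1) B(1) assms(6) unfolding consecutive_def by auto
  show "Max ?A \<le> x" "y \<le> Min ?B" using A(1) B(1) by auto
qed

section \<open>Cut parameters and the edges of a subdivision\<close>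

text \<open>Cuts are recorded as parameters rather than points, because the base point of a
  self-loop is met at both parameters \<open>0\<close> and \<open>L\<close>.\<close>

definition cuts :: "'a set \<Rightarrow> real \<Rightarrow> (real \<Rightarrow> 'a) \<Rightarrow> real set" where
  "cuts W L \<gamma> = {t\<in>{0..L}. \<gamma> t \<in> W}"

text \<open>The right-hand side is the condition by which \<open>subdivide\<close> selects its
  pieces, so facts about gaps become facts about pieces.\<close>

lemma consecutive_cuts_iff:
  "(a, b) \<in> consecutive (cuts W L \<gamma>) \<longleftrightarrow>
     0 \<le> a \<and> a < b \<and> b \<le> L \<and> \<gamma> a \<in> W \<and> \<gamma> b \<in> W \<and> (\<forall>t\<in>{a<..<b}. \<gamma> t \<notin> W)"
proof -
  have "t \<in> {0..L}" if "0 \<le> a" "b \<le> L" "a < t" "t < b" for t using that by auto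
  then show ?thesis unfolding consecutive_def cuts_def by auto (smt (verit))
qed

lemma verts_subdivide [simp]: "verts (subdivide G S) = verts G \<union> S"
  by (simp add: subdivide_def)

lemma edges_subdivide:
  "edges (subdivide G S) = {(b - a, \<lambda>t. \<gamma> (a + t)) | L \<gamma> a b.
     (L, \<gamma>) \<in> edges G \<and> (a, b) \<in> consecutive (cuts (verts G \<union> S) L \<gamma>)}"
  unfolding subdivide_def consecutive_cuts_iff by simp

lemma piece_in_subdivide:
  assumes "(L, \<gamma>) \<in> edges G" "(a, b) \<in> consecutive (cuts (verts G \<union> S) L \<gamma>)"
  shows "(b - a, \<lambda>t. \<gamma> (a + t)) \<in> edges (subdivide G S)"
  using assms by (auto simp: edges_subdivide)

lemma edge_endsI: "(L, \<gamma>) \<in> edges G \<Longrightarrow> (\<gamma> 0, \<gamma> L) \<in> edge_ends G"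
  by (auto simp: edge_ends_def)

lemma interior_in_points: "(L, \<gamma>) \<in> edges G \<Longrightarrow> t \<in> {0<..<L} \<Longrightarrow> \<gamma> t \<in> points G"
  unfolding points_def edge_interior_def by (auto intro!: bexI[of _ "(L, \<gamma>)"])

context metrized_graph begin

text \<open>The parametrization is injective only on the open interval. Finiteness is obtained there
  from a preimage of a finite set, and the two ends are added.\<close>

lemma finite_cuts:
  assumes "(L, \<gamma>) \<in> edges G" "finite S"
  shows "finite (cuts (verts G \<union> S) L \<gamma>)"
proof -
  have "finite {t \<in> {0<..<L}. \<gamma> t \<in> verts G \<union> S}"
    using finite_vimage_IntI[OF _ edge_inj[OF assms(1)], of "verts G \<union> S"] assms(2) finite_verts
    by (simp add: vimage_def Int_def conj_commute)
  then have "finite (insert 0 (insert L {t \<in> {0<..<L}. \<gamma> t \<in> verts G \<union> S}))" by simp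
  then show ?thesis by (rule finite_subset[rotated]) (auto simp: cuts_def)
qed

lemma ends_in_cuts:
  assumes "(L, \<gamma>) \<in> edges G"
  shows "0 \<in> cuts (verts G \<union> S) L \<gamma>" "L \<in> cuts (verts G \<union> S) L \<gamma>"
  using length_pos[OF assms] start_in_verts[OF assms] end_in_verts[OF assms]
  by (auto simp: cuts_def)

lemma Min_Max_cuts:
  assumes "(L, \<gamma>) \<in> edges G" "finite S"
  shows "Min (cuts (verts G \<union> S) L \<gamma>) = 0" "Max (cuts (verts G \<union> S) L \<gamma>) = L"
  using finite_cuts[OF assms] ends_in_cuts[OF assms(1), of S]
  by (auto intro!: Min_eqI Max_eqI) (auto simp: cuts_def)

lemma consecutive_cutsD:
  assumes "(a, b) \<in> consecutive (cuts W L \<gamma>)"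
  shows "0 \<le> a" "a < b" "b \<le> L" "\<gamma> a \<in> W" "\<gamma> b \<in> W" "\<And>t. a < t \<Longrightarrow> t < b \<Longrightarrow> \<gamma> t \<notin> W"
  using assms by (auto simp: consecutive_cuts_iff)

text \<open>Disjointness of edge interiors identifies the edge, and injectivity inside it identifies
  the parameter.\<close>

lemma interior_eqD:
  assumes "(L, \<gamma>) \<in> edges G" "(L', \<gamma>') \<in> edges G" "t \<in> {0<..<L}" "t' \<in> {0<..<L'}" "\<gamma> t = \<gamma>' t'"
  shows "L = L'" "\<gamma> = \<gamma>'" "t = t'"
proof -
  have "\<gamma> t \<in> edge_interior (L, \<gamma>)" "\<gamma>' t' \<in> edge_interior (L', \<gamma>')"
    using assms(3,4) by (auto simp: edge_interior_def)
  then have "\<gamma> t \<in> edge_interior (L, \<gamma>) \<inter> edge_interior (L', \<gamma>')"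
    using assms(5) by simp
  then have "(L, \<gamma>) = (L', \<gamma>')" using interior_disjoint[OF assms(1,2)] by blast
  then show "L = L'" "\<gamma> = \<gamma>'" "t = t'"
    using edge_inj[OF assms(1)] assms by (auto dest: inj_onD)
qed

lemma interior_notin_verts:
  assumes "(L, \<gamma>) \<in> edges G" "t \<in> {0<..<L}"
  shows "\<gamma> t \<notin> verts G"
  using interior_verts[OF assms(1)] imageI[OF assms(2), of \<gamma>] by (auto simp: edge_interior_def)

lemma edge_in_points:
  assumes "(L, \<gamma>) \<in> edges G" "t \<in> {0..L}"
  shows "\<gamma> t \<in> points G"
proof (cases "t = 0 \<or> t = L")
  case True
  then show ?thesis using start_in_verts[OF assms(1)] end_in_verts[OF assms(1)] by (auto simp: points_def)
next
  case False
  then show ?thesis using assms by (force simp: points_def edge_interior_def)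
qed

lemma points_cases:
  assumes "x \<in> points G"
  obtains "x \<in> verts G" | L \<gamma> t where "(L, \<gamma>) \<in> edges G" "t \<in> {0<..<L}" "x = \<gamma> t"
  using assms by (auto simp: points_def edge_interior_def)

text \<open>By \<open>interior_eqD\<close> both pieces lie on one edge and share a parameter inside
  their gaps; gaps that overlap in this way coincide.\<close>

lemma piece_eqD:
  assumes "(L, \<gamma>) \<in> edges G" "(L', \<gamma>') \<in> edges G"
    "(a, b) \<in> consecutive (cuts W L \<gamma>)" "(a', b') \<in> consecutive (cuts W L' \<gamma>')"
    "t \<in> {0<..<b-a}" "t' \<in> {0<..<b'-a'}" "\<gamma> (a + t) = \<gamma>' (a' + t')"
  shows "L = L' \<and> \<gamma> = \<gamma>' \<and> a = a' \<and> b = b'"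
proof -
  have "a + t \<in> {0<..<L}" "a' + t' \<in> {0<..<L'}"
    using consecutive_cutsD[OF assms(3)] consecutive_cutsD[OF assms(4)] assms(5,6) by auto
  note e = interior_eqD[OF assms(1,2) this assms(7)]
  show ?thesis using e assms(3-6) consecutive_overlap[of a b _ a' b' "a + t"] by auto
qed

lemma finite_pieces:
  assumes "finite S"
  shows "finite (SIGMA e:edges G. consecutive (cuts (verts G \<union> S) (fst e) (snd e)))"
  using finite_edges finite_consecutive[OF finite_cuts[OF _ assms]]
  by (intro finite_SigmaI) (metis prod.collapse)+

text \<open>Reindexing along the map from pairs of an edge and a gap to pieces. The map is injective
  because an interior point, here the midpoint, determines the piece on which it lies.\<close>

lemma sum_edges_subdivide:
  fixes F :: "real \<times> (real \<Rightarrow> 'a) \<Rightarrow> real"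
  assumes "finite S"
  shows "sum F (edges (subdivide G S)) = (\<Sum>(L, \<gamma>)\<in>edges G.
    \<Sum>(a, b)\<in>consecutive (cuts (verts G \<union> S) L \<gamma>). F (b - a, \<lambda>t. \<gamma> (a + t)))"
proof -
  let ?X = "SIGMA e:edges G. consecutive (cuts (verts G \<union> S) (fst e) (snd e))"
  let ?p = "\<lambda>(e, a, b). (b - a, \<lambda>t. snd e (a + t))"
  have "inj_on ?p ?X"
  proof (rule inj_onI, clarsimp)
    fix L \<gamma> a b L' \<gamma>' a' b'
    assume *: "(L, \<gamma>) \<in> edges G" "(L', \<gamma>') \<in> edges G"
      "(a, b) \<in> consecutive (cuts (verts G \<union> S) L \<gamma>)"
      "(a', b') \<in> consecutive (cuts (verts G \<union> S) L' \<gamma>')"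
      "b - a = b' - a'" "(\<lambda>t. \<gamma> (a + t)) = (\<lambda>t. \<gamma>' (a' + t))"
    then show "L = L' \<and> \<gamma> = \<gamma>' \<and> a = a' \<and> b = b'"
      using piece_eqD[OF *(1-4), of "(b-a)/2" "(b-a)/2"] consecutive_cutsD(2)[OF *(3)]
      by (metis (no_types, lifting) diff_gt_0_iff_gt field_sum_of_halves greaterThanLessThan_iff half_gt_zero less_add_same_cancel2)
  qed
  moreover have "edges (subdivide G S) = ?p ` ?X"
    unfolding edges_subdivide by (force simp: image_iff)
  ultimately have "sum F (edges (subdivide G S)) = sum (F \<circ> ?p) ?X"
    by (simp add: sum.reindex)
  also have "\<dots> = (\<Sum>e\<in>edges G. \<Sum>x\<in>consecutive (cuts (verts G \<union> S) (fst e) (snd e)). (F \<circ> ?p) (e, x))"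
    using finite_edges finite_consecutive[OF finite_cuts[OF _ assms]]
    by (subst sum.Sigma) (auto simp: case_prod_unfold)
  finally show ?thesis by (simp add: case_prod_unfold)
qed

lemma finite_edges_subdivide:
  assumes "finite S"
  shows "finite (edges (subdivide G S))"
proof -
  have "finite ((\<lambda>(e, a, b). (b - a, \<lambda>t. snd e (a + t))) `
     (SIGMA e:edges G. consecutive (cuts (verts G \<union> S) (fst e) (snd e))))"
    by (intro finite_imageI finite_pieces[OF assms])
  then show ?thesis
    by (rule finite_subset[rotated]) (force simp: edges_subdivide image_iff)
qed

lemma points_subdivide:
  assumes "finite S" "S \<subseteq> points G"
  shows "points (subdivide G S) = points G"
proof (intro equalityI subsetI)
  fix x assume "x \<in> points (subdivide G S)"
  then consider "x \<in> verts G \<union> S" | L \<gamma> a b t where "(L, \<gamma>) \<in> edges G"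
    "(a, b) \<in> consecutive (cuts (verts G \<union> S) L \<gamma>)" "t \<in> {0<..<b-a}" "x = \<gamma> (a + t)"
    by (auto simp: points_def edge_interior_def edges_subdivide)
  then show "x \<in> points G"
  proof cases
    case 1 then show ?thesis using assms by (auto simp: points_def)
  next
    case 2
    then show ?thesis using consecutive_cutsD[OF 2(2)] edge_in_points[OF 2(1), of "a + t"] by auto
  qed
next
  fix x assume "x \<in> points G"
  then show "x \<in> points (subdivide G S)"
  proof (cases rule: points_cases)
    case 1 then show ?thesis by (simp add: points_def)
  next
    case (2 L \<gamma> t)
    show ?thesis
    proof (cases "x \<in> verts G \<union> S")
      case True then show ?thesis by (simp add: points_def)
    next
      case False
      let ?C = "cuts (verts G \<union> S) L \<gamma>"
      have "t \<notin> ?C" using False 2 by (auto simp: cuts_def)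
      \<comment> \<open>Since the cuts are finite, some interval to the right of \<open>t\<close>
        contains none, and \<open>consecutive_around\<close> yields a gap around it. As
        \<open>t\<close> itself is not a cut, it lies strictly inside that gap.\<close>
      moreover obtain e where "e > 0" "\<forall>s\<in>?C. s \<noteq> t \<longrightarrow> e \<le> dist t s"
        using finite_set_avoid[OF finite_cuts[OF 2(1) assms(1)], of t] by metis
      then obtain y where "t < y" "y \<le> L" "\<forall>s\<in>?C. \<not> (t < s \<and> s < y)"
        using 2(2) by (intro that[of "min L (t + e)"]) (fastforce simp: dist_real_def)+
      then obtain a b where ab: "(a, b) \<in> consecutive ?C" "a \<le> t" "y \<le> b"
        using consecutive_around[OF finite_cuts[OF 2(1) assms(1)] ends_in_cuts[OF 2(1)], of t y] 2(2)
        by auto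
      moreover have "a \<noteq> t" using ab \<open>t \<notin> ?C\<close> by (auto simp: consecutive_def)
      ultimately have "x = \<gamma> (a + (t - a)) \<and> t - a \<in> {0<..<b-a}"
        using 2 \<open>t < y\<close> by auto
      moreover have "(b - a, \<lambda>t. \<gamma> (a + t)) \<in> edges (subdivide G S)"
        using ab 2 by (auto simp: edges_subdivide)
      ultimately show ?thesis
        using interior_in_points[of "b - a" "\<lambda>t. \<gamma> (a + t)" "subdivide G S" "t - a"] by simp
    qed
  qed
qed

text \<open>Induction on the number of smaller cuts: the last cut before \<open>c\<close> is joined
  to \<open>c\<close> by a piece of the edge.\<close>

lemma cut_reachable:
  assumes "(L, \<gamma>) \<in> edges G" "finite S" "c \<in> cuts (verts G \<union> S) L \<gamma>"
  shows "(\<gamma> 0, \<gamma> c) \<in> (edge_ends (subdivide G S))\<^sup>*"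
proof -
  let ?C = "cuts (verts G \<union> S) L \<gamma>"
  have fin: "finite ?C" using finite_cuts[OF assms(1,2)] .
  show ?thesis using assms(3)
  proof (induction "card {t\<in>?C. t < c}" arbitrary: c rule: less_induct)
    case less
    show ?case
    proof (cases "c = 0")
      case False
      let ?A = "{t\<in>?C. t < c}"
      have "0 \<in> ?A" using less.prems False ends_in_cuts[OF assms(1)] by (auto simp: cuts_def)
      then have "Max ?A \<in> ?A" using fin by (intro Max_in) auto
      then have A: "Max ?A \<in> ?A" "\<And>t. t \<in> ?A \<Longrightarrow> t \<le> Max ?A" using fin by auto
      have "{t\<in>?C. t < Max ?A} \<subset> ?A" using A(1) by auto
      then have "card {t\<in>?C. t < Max ?A} < card ?A" by (intro psubset_card_mono) (use fin in auto)
      then have IH: "(\<gamma> 0, \<gamma> (Max ?A)) \<in> (edge_ends (subdivide G S))\<^sup>*"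
        using less.hyps[of "Max ?A"] A(1) by auto
      have "(Max ?A, c) \<in> consecutive ?C"
        using A less.prems unfolding consecutive_def by fastforce
      then have "(c - Max ?A, \<lambda>t. \<gamma> (Max ?A + t)) \<in> edges (subdivide G S)"
        using assms(1) by (auto simp: edges_subdivide)
      then have "(\<gamma> (Max ?A), \<gamma> c) \<in> edge_ends (subdivide G S)"
        using edge_endsI by fastforce
      with IH show ?thesis by (rule rtrancl_into_rtrancl)
    qed simp
  qed
qed

lemma metrized_graph_subdivide:
  assumes "finite S" "S \<subseteq> points G"
  shows "metrized_graph (subdivide G S)"
proof
  show "finite (verts (subdivide G S))" "verts (subdivide G S) \<noteq> {}"
    using finite_verts verts_nonempty assms by auto
  show "finite (edges (subdivide G S))" by (rule finite_edges_subdivide[OF assms(1)])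
next
  fix L \<gamma> assume "(L, \<gamma>) \<in> edges (subdivide G S)"
  then obtain L' \<gamma>' a b where *: "L = b - a" "\<gamma> = (\<lambda>t. \<gamma>' (a + t))" "(L', \<gamma>') \<in> edges G"
    "(a, b) \<in> consecutive (cuts (verts G \<union> S) L' \<gamma>')" by (auto simp: edges_subdivide)
  note c = consecutive_cutsD[OF *(4)]
  show "0 < L" "\<gamma> 0 \<in> verts (subdivide G S)" "\<gamma> L \<in> verts (subdivide G S)"
    using c * by auto
  show "inj_on \<gamma> {0<..<L}"
  proof (rule inj_onI)
    fix s t assume "s \<in> {0<..<L}" "t \<in> {0<..<L}" "\<gamma> s = \<gamma> t"
    then show "s = t"
      using c * inj_onD[OF edge_inj[OF *(3)], of "a + s" "a + t"] by auto
  qed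
next
  fix e assume "e \<in> edges (subdivide G S)"
  then obtain L \<gamma> a b where *: "e = (b - a, \<lambda>t. \<gamma> (a + t))" "(L, \<gamma>) \<in> edges G"
    "(a, b) \<in> consecutive (cuts (verts G \<union> S) L \<gamma>)" by (auto simp: edges_subdivide)
  have "\<gamma> (a + t) \<notin> verts G \<union> S" if "t \<in> {0<..<b-a}" for t
    using consecutive_cutsD(6)[OF *(3), of "a + t"] that by auto
  then show "edge_interior e \<inter> verts (subdivide G S) = {}"
    using * by (auto simp: edge_interior_def)
next
  fix e e' assume "e \<in> edges (subdivide G S)" "e' \<in> edges (subdivide G S)" "e \<noteq> e'"
  then show "edge_interior e \<inter> edge_interior e' = {}"
    using piece_eqD unfolding edges_subdivide edge_interior_def by (clarsimp simp: disjoint_iff) (metis (lifting) greaterThanLessThan_iff)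
next
  \<comment> \<open>Connectedness: each old edge becomes a path of pieces, and each new vertex lies
    on such a path that starts at an old vertex.\<close>
  let ?R = "edge_ends (subdivide G S) \<union> (edge_ends (subdivide G S))\<inverse>"
  have sym: "(v, u) \<in> ?R\<^sup>*" if "(u, v) \<in> ?R\<^sup>*" for u v
    using that by (metis converse_Un converse_converse rtrancl_converseI sup_commute)
  have reach: "(\<gamma> 0, \<gamma> c) \<in> ?R\<^sup>*" if "(L, \<gamma>) \<in> edges G" "c \<in> cuts (verts G \<union> S) L \<gamma>" for L \<gamma> c
    using cut_reachable[OF that(1) assms(1) that(2)] by (rule rtrancl_mono[THEN subsetD, rotated]) auto
  have "edge_ends G \<subseteq> ?R\<^sup>*"
    using reach ends_in_cuts(2) unfolding edge_ends_def by blast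
  then have sub: "edge_ends G \<union> (edge_ends G)\<inverse> \<subseteq> ?R\<^sup>*"
    using sym by auto
  have old: "(u, v) \<in> ?R\<^sup>*" if "u \<in> verts G" "v \<in> verts G" for u v
    using connected[OF that] rtrancl_mono[OF sub] by auto
  have to_old: "\<exists>v\<in>verts G. (v, u) \<in> ?R\<^sup>*" if u: "u \<in> verts G \<union> S" for u
  proof -
    have "u \<in> points G" using u assms(2) by (auto simp: points_def)
    then show ?thesis
    proof (cases rule: points_cases)
      case (2 L \<gamma> t)
      then have "t \<in> cuts (verts G \<union> S) L \<gamma>" using u by (auto simp: cuts_def)
      then show ?thesis using reach[OF 2(1)] start_in_verts[OF 2(1)] 2(3) by auto
    qed auto
  qed
  fix u v assume "u \<in> verts (subdivide G S)" "v \<in> verts (subdivide G S)"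
  then show "(u, v) \<in> ?R\<^sup>*"
    using to_old[of u] to_old[of v] old sym by (metis rtrancl_trans verts_subdivide)
qed

text \<open>A gap inside a gap is a gap for the union of the cut points, and each gap for the union
  lies in one of the first stage. The graphs are literally equal, because the parameter shifts of
  the two stages add up.\<close>

lemma subdivide_subdivide:
  assumes "finite S"
  shows "subdivide (subdivide G S) T = subdivide G (S \<union> T)"
proof -
  have "edges (subdivide (subdivide G S) T) = edges (subdivide G (S \<union> T))"
  proof (intro equalityI subsetI)
    fix e assume "e \<in> edges (subdivide (subdivide G S) T)"
    then obtain L \<gamma> a' b' a b where *: "(L, \<gamma>) \<in> edges G"
      "(a', b') \<in> consecutive (cuts (verts G \<union> S) L \<gamma>)"
      "(a, b) \<in> consecutive (cuts (verts G \<union> S \<union> T) (b' - a') (\<lambda>t. \<gamma> (a' + t)))"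
      "e = (b - a, \<lambda>t. \<gamma> (a' + (a + t)))"
      unfolding edges_subdivide[of "subdivide G S"] by (auto simp: edges_subdivide[of G])
    note c = consecutive_cutsD[OF *(2)] and d = consecutive_cutsD[OF *(3)]
    have "\<gamma> t \<notin> verts G \<union> S \<union> T" if "a' + a < t" "t < a' + b" for t
      using d(6)[of "t - a'"] that by auto
    then have "(a' + a, a' + b) \<in> consecutive (cuts (verts G \<union> (S \<union> T)) L \<gamma>)"
      using c(1-3) d(1-5) unfolding consecutive_def cuts_def by (auto simp: Un_assoc)
    moreover have "e = ((a' + b) - (a' + a), \<lambda>t. \<gamma> ((a' + a) + t))"
      using * by (simp add: add.assoc)
    ultimately show "e \<in> edges (subdivide G (S \<union> T))"
      unfolding edges_subdivide using *(1) by blast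
  next
    fix e assume "e \<in> edges (subdivide G (S \<union> T))"
    then obtain L \<gamma> a b where *: "(L, \<gamma>) \<in> edges G"
      "(a, b) \<in> consecutive (cuts (verts G \<union> (S \<union> T)) L \<gamma>)" "e = (b - a, \<lambda>t. \<gamma> (a + t))"
      by (auto simp: edges_subdivide)
    note c = consecutive_cutsD[OF *(2)]
    have "\<forall>t\<in>cuts (verts G \<union> S) L \<gamma>. \<not> (a < t \<and> t < b)"
      using c(6) by (auto simp: cuts_def)
    then obtain a' b' where ab: "(a', b') \<in> consecutive (cuts (verts G \<union> S) L \<gamma>)" "a' \<le> a" "b \<le> b'"
      using consecutive_around[OF finite_cuts[OF *(1) assms] ends_in_cuts[OF *(1)], of a b] c by auto
    have "(a - a', b - a') \<in> consecutive (cuts (verts (subdivide G S) \<union> T) (b' - a') (\<lambda>t. \<gamma> (a' + t)))"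
      using c ab unfolding consecutive_def cuts_def by auto
    moreover have "e = ((b - a') - (a - a'), \<lambda>t. \<gamma> (a' + ((a - a') + t)))"
      using * by simp
    moreover have "(b' - a', \<lambda>t. \<gamma> (a' + t)) \<in> edges (subdivide G S)"
      using ab *(1) by (auto simp: edges_subdivide)
    ultimately show "e \<in> edges (subdivide (subdivide G S) T)"
      using piece_in_subdivide[of "b' - a'" "\<lambda>t. \<gamma> (a' + t)" "subdivide G S" "a - a'" "b - a'" T] by simp
  qed
  moreover have "verts (subdivide (subdivide G S) T) = verts (subdivide G (S \<union> T))" by auto
  ultimately show ?thesis by (simp add: subdivide_def)
qed

text \<open>Edge interiors avoid the vertices, so the only gap of an edge is the whole edge.\<close>

lemma subdivide_verts:
  assumes "S \<subseteq> verts G"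
  shows "subdivide G S = G"
proof -
  have W: "verts G \<union> S = verts G" using assms by auto
  have cons: "consecutive (cuts (verts G) L \<gamma>) = {(0, L)}" if e: "(L, \<gamma>) \<in> edges G" for L \<gamma>
  proof -
    have "t = 0 \<or> t = L" if "t \<in> cuts (verts G) L \<gamma>" for t
      using that interior_notin_verts[OF e, of t]
      by (cases "0 < t"; cases "t < L") (auto simp: cuts_def)
    then have "cuts (verts G) L \<gamma> = {0, L}"
      using ends_in_cuts[OF e, of "{}"] by auto
    then show ?thesis using length_pos[OF e] by (auto simp: consecutive_def)
  qed
  have "(L, \<gamma>) \<in> edges (subdivide G S)" if "(L, \<gamma>) \<in> edges G" for L \<gamma>
    using piece_in_subdivide[of L \<gamma> G 0 L S] that cons[OF that] by (simp add: W)
  moreover have "edges (subdivide G S) \<subseteq> edges G"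
    unfolding edges_subdivide W using cons by auto
  ultimately have "edges (subdivide G S) = edges G"
    by auto
  then show ?thesis using W by (simp add: subdivide_def)
qed

end

section \<open>Dirichlet form and potentials\<close>

text \<open>For functions affine along edges this is the integral of the product of their
  derivatives. Only the values at vertices enter, so arbitrary functions can be used for
  testing.\<close>

definition dirichlet :: "'a mgraph \<Rightarrow> ('a \<Rightarrow> real) \<Rightarrow> ('a \<Rightarrow> real) \<Rightarrow> real" where
  "dirichlet G f g = (\<Sum>(L, \<gamma>)\<in>edges G. (f (\<gamma> L) - f (\<gamma> 0)) * (g (\<gamma> L) - g (\<gamma> 0)) / L)"

definition edge_affine :: "'a mgraph \<Rightarrow> ('a \<Rightarrow> real) \<Rightarrow> bool" where
  "edge_affine G f \<longleftrightarrow> (\<forall>(L, \<gamma>)\<in>edges G. \<forall>t\<in>{0..L}.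
     f (\<gamma> t) = f (\<gamma> 0) + t / L * (f (\<gamma> L) - f (\<gamma> 0)))"

lemma edge_affineD:
  "edge_affine G f \<Longrightarrow> (L, \<gamma>) \<in> edges G \<Longrightarrow> 0 \<le> t \<Longrightarrow> t \<le> L \<Longrightarrow>
     f (\<gamma> t) = f (\<gamma> 0) + t / L * (f (\<gamma> L) - f (\<gamma> 0))"
  unfolding edge_affine_def by (drule (1) bspec) (simp only: prod.case atLeastAtMost_iff Ball_def)

lemma dirichlet_sym: "dirichlet G f g = dirichlet G g f"
  by (simp add: dirichlet_def mult.commute)

lemma dirichlet_add: "dirichlet G (\<lambda>x. f x + h x) g = dirichlet G f g + dirichlet G h g"
  unfolding dirichlet_def by (simp add: sum.distrib[symmetric] case_prod_unfold algebra_simps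
    add_divide_distrib diff_divide_distrib)

lemma dirichlet_diff: "dirichlet G (\<lambda>x. f x - h x) g = dirichlet G f g - dirichlet G h g"
  unfolding dirichlet_def by (simp add: sum_subtractf[symmetric] case_prod_unfold algebra_simps
    add_divide_distrib diff_divide_distrib)

lemma dirichlet_scale: "dirichlet G (\<lambda>x. c * f x) g = c * dirichlet G f g"
  unfolding dirichlet_def by (simp add: sum_distrib_left case_prod_unfold algebra_simps)

lemma dirichlet_scale_right: "dirichlet G f (\<lambda>x. c * g x) = c * dirichlet G f g"
  using dirichlet_scale[of G c g f] by (simp add: dirichlet_sym)

text \<open>Induction step: two solutions for the smaller family, obtained by dropping different unknowns,
  are independent, and a combination of them kills the additional functional.\<close>

lemma common_zero_of_functionals:
  fixes l :: "'b \<Rightarrow> ('a \<Rightarrow> real) \<Rightarrow> real"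
  assumes "finite V"
    and add: "\<And>v f g. l v (\<lambda>x. f x + g x) = l v f + l v g"
    and scale: "\<And>v c f. l v (\<lambda>x. c * f x) = c * l v f"
    and "finite W" "card V < card W"
  shows "\<exists>f. (\<exists>w\<in>W. f w \<noteq> 0) \<and> (\<forall>w. w \<notin> W \<longrightarrow> f w = 0) \<and> (\<forall>v\<in>V. l v f = 0)"
  using assms(1,4,5)
proof (induction V arbitrary: W rule: finite_induct)
  case empty
  then obtain w where "w \<in> W" by (metis card.empty less_irrefl ex_in_conv)
  then show ?case by (intro exI[of _ "\<lambda>x. of_bool (x = w)"]) auto
next
  case (insert v V)
  have IH: "\<exists>f. (\<exists>w\<in>W - {u}. f w \<noteq> 0) \<and> (\<forall>w. w \<notin> W - {u} \<longrightarrow> f w = 0) \<and> (\<forall>v\<in>V. l v f = 0)"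
    if "u \<in> W" for u
    using that insert by (intro insert.IH) auto
  obtain u where "u \<in> W" using insert.prems by fastforce
  from IH[OF this] obtain f where
    f: "\<exists>w\<in>W - {u}. f w \<noteq> 0" "\<And>w. w \<notin> W - {u} \<Longrightarrow> f w = 0" "\<And>v. v \<in> V \<Longrightarrow> l v f = 0" by auto
  then obtain w where w: "w \<in> W" "f w \<noteq> 0" by auto
  from IH[OF this(1)] obtain g where
    g: "\<exists>z\<in>W - {w}. g z \<noteq> 0" "\<And>z. z \<notin> W - {w} \<Longrightarrow> g z = 0" "\<And>v. v \<in> V \<Longrightarrow> l v g = 0" by auto
  show ?case
  proof (cases "l v f = 0")
    case True
    then show ?thesis using f w by (intro exI[of _ f]) auto
  next
    case False
    let ?h = "\<lambda>x. l v g * f x + (- l v f) * g x"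
    have "l u ?h = l v g * l u f + (- l v f) * l u g" for u
      by (simp only: add scale)
    then have "\<forall>u\<in>insert v V. l u ?h = 0" using f(3) g(3) by auto
    moreover have "\<forall>w. w \<notin> W \<longrightarrow> ?h w = 0" using f(2) g(2) by auto
    moreover have "\<exists>z\<in>W. ?h z \<noteq> 0"
    proof (cases "l v g = 0")
      case True
      then show ?thesis using g(1) False by auto
    next
      case g0: False
      have "?h w = l v g * f w" using g(2)[of w] by simp
      then show ?thesis using w g0 by (intro bexI[of _ w]) auto
    qed
    ultimately show ?thesis by (intro exI[of _ ?h] conjI)
  qed
qed

context metrized_graph begin

section \<open>Weak form of Kirchhoff's law\<close>

text \<open>An edge pairs with the indicator of \<open>v\<close> through those of its ends that are
  at \<open>v\<close>; a self-loop contributes \<open>0\<close> on both sides.\<close>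

lemma outflow_eq_dirichlet: "outflow G f v = dirichlet G f (\<lambda>x. of_bool (x = v))"
proof -
  have "dirichlet G f (\<lambda>x. of_bool (x = v)) =
    (\<Sum>(L, \<gamma>)\<in>edges G. (if \<gamma> 0 = v then (f (\<gamma> 0) - f (\<gamma> L)) / L else 0)) +
    (\<Sum>(L, \<gamma>)\<in>edges G. (if \<gamma> L = v then (f (\<gamma> L) - f (\<gamma> 0)) / L else 0))"
    unfolding dirichlet_def sum.distrib[symmetric]
    by (intro sum.cong) (auto simp: diff_divide_distrib)
  also have "\<dots> = outflow G f v"
    unfolding outflow_def using finite_edges
    by (intro arg_cong2[where f = "(+)"] sum.mono_neutral_cong_right) (auto split: if_splits)
  finally show ?thesis by simp
qed

text \<open>Summation by parts: after exchanging the sums over vertices and edges, each edge picks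
  out the values of \<open>g\<close> at its two ends.\<close>

lemma sum_outflow: "(\<Sum>v\<in>verts G. g v * outflow G f v) = dirichlet G f g"
proof -
  have "(\<Sum>v\<in>verts G. g v * outflow G f v) =
    (\<Sum>(L, \<gamma>)\<in>edges G. \<Sum>v\<in>verts G. g v * ((f (\<gamma> L) - f (\<gamma> 0)) * (of_bool (\<gamma> L = v) - of_bool (\<gamma> 0 = v)) / L))"
    unfolding outflow_eq_dirichlet dirichlet_def sum_distrib_left case_prod_unfold
    by (rule sum.swap)
  also have "\<dots> = dirichlet G f g"
    unfolding dirichlet_def
  proof (intro sum.cong refl, clarify)
    fix L \<gamma> assume e: "(L, \<gamma>) \<in> edges G"
    have "(\<Sum>v\<in>verts G. g v * ((f (\<gamma> L) - f (\<gamma> 0)) * (of_bool (\<gamma> L = v) - of_bool (\<gamma> 0 = v)) / L))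
      = (\<Sum>v\<in>verts G. (if \<gamma> L = v then (f (\<gamma> L) - f (\<gamma> 0)) * g v / L else 0))
       - (\<Sum>v\<in>verts G. (if \<gamma> 0 = v then (f (\<gamma> L) - f (\<gamma> 0)) * g v / L else 0))"
      unfolding sum_subtractf[symmetric] by (intro sum.cong) (auto simp: algebra_simps diff_divide_distrib add_divide_distrib)
    also have "\<dots> = (f (\<gamma> L) - f (\<gamma> 0)) * (g (\<gamma> L) - g (\<gamma> 0)) / L"
      using finite_verts start_in_verts[OF e] end_in_verts[OF e]
      by (simp add: algebra_simps diff_divide_distrib add_divide_distrib)
    finally show "(\<Sum>v\<in>verts G. g v * ((f (\<gamma> L) - f (\<gamma> 0)) * (of_bool (\<gamma> L = v) - of_bool (\<gamma> 0 = v)) / L))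
      = (f (\<gamma> L) - f (\<gamma> 0)) * (g (\<gamma> L) - g (\<gamma> 0)) / L" .
  qed
  finally show ?thesis .
qed

text \<open>One direction is summation by parts, the other tests with indicators of
  vertices.\<close>

lemma kirchhoff_iff_dirichlet:
  assumes "y \<in> verts G" "z \<in> verts G"
  shows "(\<forall>v\<in>verts G. outflow G f v = of_bool (v = y) - of_bool (v = z)) \<longleftrightarrow>
    (\<forall>g. dirichlet G f g = g y - g z)"
proof
  assume *: "\<forall>v\<in>verts G. outflow G f v = of_bool (v = y) - of_bool (v = z)"
  show "\<forall>g. dirichlet G f g = g y - g z"
  proof
    fix g
    have "dirichlet G f g = (\<Sum>v\<in>verts G. (if v = y then g v else 0)) - (\<Sum>v\<in>verts G. (if v = z then g v else 0))"
      unfolding sum_outflow[symmetric] sum_subtractf[symmetric] using * by (intro sum.cong) auto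
    then show "dirichlet G f g = g y - g z" using assms finite_verts by simp
  qed
next
  assume "\<forall>g. dirichlet G f g = g y - g z"
  then show "\<forall>v\<in>verts G. outflow G f v = of_bool (v = y) - of_bool (v = z)"
    by (simp add: outflow_eq_dirichlet eq_commute)
qed

lemma dirichlet_nonneg: "dirichlet G f f \<ge> 0"
  unfolding dirichlet_def by (intro sum_nonneg) (auto dest: length_pos)

text \<open>Each summand is nonnegative and hence zero, so \<open>f\<close> agrees at the two ends
  of every edge, and connectedness spreads this to all vertices.\<close>

lemma dirichlet_zero_const:
  assumes "dirichlet G f f = 0" "u \<in> verts G" "v \<in> verts G"
  shows "f u = f v"
proof -
  have "\<forall>e\<in>edges G. (\<lambda>(L, \<gamma>). (f (\<gamma> L) - f (\<gamma> 0)) * (f (\<gamma> L) - f (\<gamma> 0)) / L) e = 0"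
    using assms(1) finite_edges length_pos unfolding dirichlet_def
    by (subst (asm) sum_nonneg_eq_0_iff) (auto simp: less_imp_le)
  then have "f (\<gamma> L) = f (\<gamma> 0)" if "(L, \<gamma>) \<in> edges G" for L \<gamma>
    using that length_pos[OF that] by fastforce
  then have step: "f a = f b" if "(a, b) \<in> edge_ends G \<union> (edge_ends G)\<inverse>" for a b
    using that by (auto simp: edge_ends_def)
  from connected[OF assms(2,3)] show ?thesis
    by (induction rule: rtrancl_induct) (metis step)+
qed

lemma dirichlet_cong:
  assumes "\<And>v. v \<in> verts G \<Longrightarrow> f v = f' v" "\<And>v. v \<in> verts G \<Longrightarrow> g v = g' v"
  shows "dirichlet G f g = dirichlet G f' g'"
  unfolding dirichlet_def using assms start_in_verts end_in_verts by (intro sum.cong) auto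

lemma dirichlet_const_right: "dirichlet G f (\<lambda>_. c) = 0"
  by (simp add: dirichlet_def)

section \<open>Existence and uniqueness of potentials\<close>

text \<open>Kirchhoff's law away from \<open>z\<close> with unknown total current is a homogeneous
  system with one more unknown than equations. In a nonzero solution the current cannot vanish:
  otherwise the energy would be zero, the potential constant, and all unknowns zero. Dividing by the
  current makes it a unit current.\<close>

lemma vertex_potential_exists:
  assumes "y \<in> verts G" "z \<in> verts G"
  shows "\<exists>f. f z = 0 \<and> (\<forall>g. dirichlet G f g = g y - g z)"
proof (cases "y = z")
  case True
  then show ?thesis by (intro exI[of _ "\<lambda>_. 0"]) (simp add: dirichlet_def)
next
  case False
  let ?V = "verts G - {z}"
  \<comment> \<open>The value at the grounded vertex is not an unknown, so it serves as the unknown total current.\<close>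
  let ?l = "\<lambda>v f. dirichlet G (\<lambda>x. if x = z then 0 else f x) (\<lambda>x. of_bool (x = v)) - f z * of_bool (v = y)"
  have "\<exists>f. (\<exists>w\<in>verts G. f w \<noteq> 0) \<and> (\<forall>w. w \<notin> verts G \<longrightarrow> f w = 0) \<and> (\<forall>v\<in>?V. ?l v f = 0)"
  proof (rule common_zero_of_functionals)
    show "finite ?V" "finite (verts G)" "card ?V < card (verts G)"
      using finite_verts assms by (auto intro!: card_Diff1_less simp del: card_Diff_insert card_Diff_singleton)
    fix v and f g :: "'a \<Rightarrow> real" and c :: real
    have "(\<lambda>x. if x = z then 0 else f x + g x) =
      (\<lambda>x. (if x = z then 0 else f x) + (if x = z then 0 else g x))" by auto
    then show "?l v (\<lambda>x. f x + g x) = ?l v f + ?l v g"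
      by (simp only: dirichlet_add) (simp add: algebra_simps)
    have "(\<lambda>x. if x = z then 0 else c * f x) = (\<lambda>x. c * (if x = z then 0 else f x))" by auto
    then show "?l v (\<lambda>x. c * f x) = c * ?l v f"
      by (simp only: dirichlet_scale) (simp add: algebra_simps)
  qed
  then obtain f where f: "\<exists>w\<in>verts G. f w \<noteq> 0" "\<And>v. v \<in> ?V \<Longrightarrow> ?l v f = 0" by blast
  define h where "h = (\<lambda>x. if x = z then 0 else f x)"
  have out: "outflow G h v = f z * of_bool (v = y)" if "v \<in> ?V" for v
    using f(2)[OF that] by (simp add: outflow_eq_dirichlet h_def)
  have E: "dirichlet G h g = f z * (g y - g z)" for g
  proof -
    \<comment> \<open>Subtracting the constant \<open>g z\<close> from the test function removes the
      term at \<open>z\<close>, where no equation was imposed.\<close>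
    have "dirichlet G h g = dirichlet G h (\<lambda>x. g x - g z)"
      by (subst (1 2) dirichlet_sym) (simp add: dirichlet_diff dirichlet_sym[of G "\<lambda>_. _"] dirichlet_const_right)
    also have "\<dots> = (\<Sum>v\<in>verts G. if v = y then f z * (g v - g z) else 0)"
      unfolding sum_outflow[symmetric]
    proof (intro sum.cong refl)
      fix v assume "v \<in> verts G"
      then show "(g v - g z) * outflow G h v = (if v = y then f z * (g v - g z) else 0)"
        using False out[of v] by (cases "v = z") auto
    qed
    also have "\<dots> = f z * (g y - g z)" using assms finite_verts by simp
    finally show ?thesis .
  qed
  have "f z \<noteq> 0"
  proof
    assume fz: "f z = 0"
    then have "dirichlet G h h = 0" using E by simp
    then have "h v = 0" if "v \<in> verts G" for v
      using dirichlet_zero_const[OF _ that assms(2), of h] by (simp add: h_def)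
    then have "f v = 0" if "v \<in> verts G" for v using that fz unfolding h_def by metis
    then show False using f(1) by auto
  qed
  then show ?thesis
    using E by (intro exI[of _ "\<lambda>x. inverse (f z) * h x"]) (simp add: dirichlet_scale h_def)
qed

text \<open>Linear interpolation is well defined since an interior point determines its edge and
  parameter; the choice operator therefore selects the only possible value.\<close>

lemma edge_affine_extension:
  "\<exists>f. edge_affine G f \<and> (\<forall>v\<in>verts G. f v = h v)"
proof -
  let ?i = "\<lambda>L \<gamma> t. h (\<gamma> 0) + t / L * (h (\<gamma> L) - h (\<gamma> 0))"
  define f where "f w = (if w \<in> verts G then h w else
    SOME c. \<exists>L \<gamma> t. (L, \<gamma>) \<in> edges G \<and> t \<in> {0<..<L} \<and> w = \<gamma> t \<and> c = ?i L \<gamma> t)" for w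
  have fv: "f v = h v" if "v \<in> verts G" for v using that by (simp add: f_def)
  have "f (\<gamma> t) = f (\<gamma> 0) + t / L * (f (\<gamma> L) - f (\<gamma> 0))" if e: "(L, \<gamma>) \<in> edges G" "t \<in> {0..L}" for L \<gamma> t
  proof -
    have ends: "f (\<gamma> 0) = h (\<gamma> 0)" "f (\<gamma> L) = h (\<gamma> L)"
      using start_in_verts[OF e(1)] end_in_verts[OF e(1)] fv by auto
    consider "t = 0" | "t = L" | "t \<in> {0<..<L}" using e(2) by force
    then show ?thesis
    proof cases
      case 3
      have "\<exists>c. \<exists>L' \<gamma>' t'. (L', \<gamma>') \<in> edges G \<and> t' \<in> {0<..<L'} \<and> \<gamma> t = \<gamma>' t' \<and> c = ?i L' \<gamma>' t'"
        using e(1) 3 by blast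
      from someI_ex[OF this] have "f (\<gamma> t) = ?i L \<gamma> t"
        unfolding f_def using interior_notin_verts[OF e(1) 3] interior_eqD[OF e(1) _ 3] by (smt (verit, best))
      then show ?thesis using ends by simp
    qed (use length_pos[OF e(1)] in auto)
  qed
  then show ?thesis using fv unfolding edge_affine_def by blast
qed

lemma is_potential_verts_iff:
  assumes "y \<in> verts G" "z \<in> verts G"
  shows "is_potential G y z f \<longleftrightarrow> edge_affine G f \<and> (\<forall>g. dirichlet G f g = g y - g z) \<and> f z = 0"
  using subdivide_verts[of "{y, z}"] assms kirchhoff_iff_dirichlet[OF assms]
  unfolding is_potential_def edge_affine_def by simp

lemma potential_verts_exists:
  assumes "y \<in> verts G" "z \<in> verts G"
  shows "\<exists>f. is_potential G y z f"
proof -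
  obtain h where h: "h z = 0" "\<forall>g. dirichlet G h g = g y - g z"
    using vertex_potential_exists[OF assms] by auto
  obtain f where f: "edge_affine G f" "\<forall>v\<in>verts G. f v = h v"
    using edge_affine_extension by metis
  have "dirichlet G f g = dirichlet G h g" for g using f by (intro dirichlet_cong) auto
  then show ?thesis using f h assms by (auto simp: is_potential_verts_iff)
qed

lemma edge_affine_eq_points:
  assumes "edge_affine G f" "edge_affine G g" "\<And>v. v \<in> verts G \<Longrightarrow> f v = g v" "x \<in> points G"
  shows "f x = g x"
  using assms(4)
proof (cases rule: points_cases)
  case (2 L \<gamma> t)
  then show ?thesis
    using edge_affineD[OF assms(1) 2(1), of t] edge_affineD[OF assms(2) 2(1), of t]
      assms(3)[OF start_in_verts[OF 2(1)]] assms(3)[OF end_in_verts[OF 2(1)]] by auto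
qed (use assms in auto)

text \<open>The difference of two potentials has zero energy, so it is constant on the vertices, and
  it vanishes at \<open>z\<close>. Being affine along edges carries the equality to all
  points.\<close>

lemma potential_verts_unique:
  assumes "y \<in> verts G" "z \<in> verts G" "is_potential G y z f" "is_potential G y z g" "x \<in> points G"
  shows "f x = g x"
proof (rule edge_affine_eq_points[OF _ _ _ assms(5)])
  note f = assms(3)[unfolded is_potential_verts_iff[OF assms(1,2)]]
  note g = assms(4)[unfolded is_potential_verts_iff[OF assms(1,2)]]
  show "edge_affine G f" "edge_affine G g" using f g by auto
  fix v assume v: "v \<in> verts G"
  have "dirichlet G (\<lambda>x. f x - g x) (\<lambda>x. f x - g x) = 0"
    unfolding dirichlet_diff using f g by simp
  from dirichlet_zero_const[OF this v assms(2)] show "f v = g v" using f g by simp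
qed

text \<open>Cutting twice at the same points is cutting once. This reduces arbitrary
  \<open>y\<close> and \<open>z\<close> to vertices.\<close>

lemma is_potential_subdivide_self:
  "is_potential (subdivide G {y, z}) y z f \<longleftrightarrow> is_potential G y z f"
  unfolding is_potential_def by (simp add: subdivide_subdivide)

lemma potential_exists:
  assumes "y \<in> points G" "z \<in> points G"
  shows "\<exists>f. is_potential G y z f"
proof -
  interpret K: metrized_graph "subdivide G {y, z}" using assms by (intro metrized_graph_subdivide) auto
  show ?thesis using K.potential_verts_exists[of y z] is_potential_subdivide_self[of y z] by auto
qed

lemma potential_unique:
  assumes "y \<in> points G" "z \<in> points G" "is_potential G y z f" "is_potential G y z g" "x \<in> points G"
  shows "f x = g x"
proof -
  interpret K: metrized_graph "subdivide G {y, z}" using assms by (intro metrized_graph_subdivide) auto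
  show ?thesis using K.potential_verts_unique[of y z f g x] is_potential_subdivide_self[of y z]
     points_subdivide[of "{y, z}"] assms by auto
qed

lemma voltage_potential:
  assumes "y \<in> points G" "z \<in> points G"
  shows "is_potential G y z (\<lambda>x. voltage G z x y)"
  using someI_ex[OF potential_exists[OF assms]] by (simp add: voltage_def)

lemma voltage_eqI:
  assumes "y \<in> points G" "z \<in> points G" "is_potential G y z f" "x \<in> points G"
  shows "voltage G z x y = f x"
  using potential_unique[OF assms(1,2) voltage_potential[OF assms(1,2)] assms(3,4)] .

section \<open>Invariance of potentials under subdivision\<close>

text \<open>All pieces of an edge share the slope of \<open>f\<close>, so the increments of
  \<open>g\<close> telescope, whatever \<open>g\<close> does inside the edge.\<close>

lemma dirichlet_subdivide:
  assumes "edge_affine G f" "finite S"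
  shows "dirichlet (subdivide G S) f g = dirichlet G f g"
proof -
  have "(\<Sum>(a, b)\<in>consecutive (cuts (verts G \<union> S) L \<gamma>).
      (f (\<gamma> b) - f (\<gamma> a)) * (g (\<gamma> b) - g (\<gamma> a)) / (b - a)) =
     (f (\<gamma> L) - f (\<gamma> 0)) * (g (\<gamma> L) - g (\<gamma> 0)) / L" if e: "(L, \<gamma>) \<in> edges G" for L \<gamma>
  proof -
    let ?C = "cuts (verts G \<union> S) L \<gamma>" and ?m = "(f (\<gamma> L) - f (\<gamma> 0)) / L"
    have ne: "?C \<noteq> {}" using ends_in_cuts[OF e] by auto
    have "(f (\<gamma> b) - f (\<gamma> a)) * (g (\<gamma> b) - g (\<gamma> a)) / (b - a) = ?m * g (\<gamma> b) - ?m * g (\<gamma> a)"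
      if ab: "(a, b) \<in> consecutive ?C" for a b
    proof -
      note c = consecutive_cutsD[OF ab]
      have "f (\<gamma> b) - f (\<gamma> a) = ?m * (b - a)"
        using edge_affineD[OF assms(1) e, of a] edge_affineD[OF assms(1) e, of b] c(1-3)
        by (simp add: algebra_simps diff_divide_distrib)
      then have "(f (\<gamma> b) - f (\<gamma> a)) * (g (\<gamma> b) - g (\<gamma> a)) / (b - a) = ?m * (g (\<gamma> b) - g (\<gamma> a))"
        using c(2) by (simp only:) simp
      then show ?thesis by (simp add: right_diff_distrib)
    qed
    then have "(\<Sum>(a, b)\<in>consecutive ?C. (f (\<gamma> b) - f (\<gamma> a)) * (g (\<gamma> b) - g (\<gamma> a)) / (b - a)) =
        (\<Sum>(a, b)\<in>consecutive ?C. ?m * g (\<gamma> b) - ?m * g (\<gamma> a))"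
      by (intro sum.cong) auto
    also have "\<dots> = ?m * g (\<gamma> L) - ?m * g (\<gamma> 0)"
      using consecutive_telescope[OF finite_cuts[OF e assms(2)] ne, of "\<lambda>t. ?m * g (\<gamma> t)"]
      by (simp add: Min_Max_cuts[OF e assms(2)])
    also have "\<dots> = ?m * (g (\<gamma> L) - g (\<gamma> 0))" by (rule right_diff_distrib[symmetric])
    finally show ?thesis by simp
  qed
  then show ?thesis
    unfolding dirichlet_def sum_edges_subdivide[OF assms(2)] by (intro sum.cong refl) auto
qed

lemma edge_affine_subdivide:
  assumes "edge_affine G f"
  shows "edge_affine (subdivide G S) f"
  unfolding edge_affine_def
proof (clarify)
  fix L' \<gamma>' t assume "(L', \<gamma>') \<in> edges (subdivide G S)" and t: "t \<in> {0..L'}"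
  then obtain L \<gamma> a b where *: "L' = b - a" "\<gamma>' = (\<lambda>t. \<gamma> (a + t))" and e: "(L, \<gamma>) \<in> edges G"
    "(a, b) \<in> consecutive (cuts (verts G \<union> S) L \<gamma>)" by (auto simp: edges_subdivide)
  note c = consecutive_cutsD[OF e(2)]
  have f: "f (\<gamma> s) = f (\<gamma> 0) + s * ((f (\<gamma> L) - f (\<gamma> 0)) / L)" if "0 \<le> s" "s \<le> L" for s
    using edge_affineD[OF assms e(1) that] by simp
  have "t / (b - a) * (f (\<gamma> b) - f (\<gamma> a)) = t * ((f (\<gamma> L) - f (\<gamma> 0)) / L)"
  proof -
    have "f (\<gamma> b) - f (\<gamma> a) = (b - a) * ((f (\<gamma> L) - f (\<gamma> 0)) / L)"
      using f[of a] f[of b] c(1-3) by (simp only: left_diff_distrib)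
    then show ?thesis using c(2) by simp
  qed
  then show "f (\<gamma>' t) = f (\<gamma>' 0) + t / L' * (f (\<gamma>' L') - f (\<gamma>' 0))"
    unfolding * using f[of a] f[of "a + t"] c(1-3) t * by (simp add: distrib_right add_divide_distrib)
qed

lemma is_potential_subdivide:
  assumes "finite S" "S \<subseteq> points G" "y \<in> points G" "z \<in> points G" "is_potential G y z f"
  shows "is_potential (subdivide G S) y z f"
proof -
  let ?K = "subdivide G {y, z}"
  have yz: "finite {y, z}" "{y, z} \<subseteq> points G" using assms by auto
  interpret K: metrized_graph ?K using yz by (rule metrized_graph_subdivide)
  interpret T: metrized_graph "subdivide ?K S"
    using assms yz by (intro K.metrized_graph_subdivide) (auto simp: points_subdivide)
  have f: "edge_affine ?K f" "\<And>g. dirichlet ?K f g = g y - g z" "f z = 0"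
    using assms(5) is_potential_subdivide_self[of y z f] by (auto simp: K.is_potential_verts_iff)
  have "is_potential (subdivide ?K S) y z f"
    using f K.edge_affine_subdivide[OF f(1)] K.dirichlet_subdivide[OF f(1) assms(1)]
    by (simp add: T.is_potential_verts_iff)
  \<comment> \<open>The definition of \<open>is_potential\<close> cuts at \<open>y\<close> and
    \<open>z\<close> after cutting at \<open>S\<close>; by \<open>subdivide_subdivide\<close> the
    order of the cuts does not matter.\<close>
  then show ?thesis
    using subdivide_subdivide[OF yz(1), of S] subdivide_subdivide[OF assms(1), of "{y, z}"] yz assms(1)
      subdivide_subdivide[of "{y, z} \<union> S" "{y, z}"] unfolding is_potential_def
    by (simp add: Un_commute Un_assoc)
qed

text \<open>A potential stays one after cutting, and potentials are unique on points. Hence any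
  finitely many points may be treated as vertices.\<close>

lemma voltage_subdivide:
  assumes "finite S" "S \<subseteq> points G" "x \<in> points G" "y \<in> points G" "z \<in> points G"
  shows "voltage (subdivide G S) z x y = voltage G z x y"
proof -
  interpret K: metrized_graph "subdivide G S" using assms by (intro metrized_graph_subdivide) auto
  show ?thesis
    using is_potential_subdivide[OF assms(1,2) _ _ voltage_potential] assms
    by (intro K.voltage_eqI) (auto simp: points_subdivide)
qed

lemma voltage_verts:
  assumes "y \<in> verts G" "z \<in> verts G"
  shows "edge_affine G (\<lambda>x. voltage G z x y)" "dirichlet G (\<lambda>x. voltage G z x y) g = g y - g z"
    "voltage G z z y = 0"
  using voltage_potential[of y z] assms by (auto simp: is_potential_verts_iff points_def)

end

section \<open>Voltages along edges\<close>

lemma dirichlet_const_left: "dirichlet G (\<lambda>_. c) g = 0"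
  by (simp add: dirichlet_def)

lemma dirichlet_uminus: "dirichlet G (\<lambda>x. - f x) g = - dirichlet G f g"
  using dirichlet_scale[of G "- 1" f g] by simp

lemma edge_affine_add: "edge_affine G f \<Longrightarrow> edge_affine G g \<Longrightarrow> edge_affine G (\<lambda>x. f x + g x)"
  unfolding edge_affine_def
proof (clarify)
  fix L \<gamma> t
  assume *: "\<forall>(L, \<gamma>)\<in>edges G. \<forall>t\<in>{0..L}. f (\<gamma> t) = f (\<gamma> 0) + t / L * (f (\<gamma> L) - f (\<gamma> 0))"
    "\<forall>(L, \<gamma>)\<in>edges G. \<forall>t\<in>{0..L}. g (\<gamma> t) = g (\<gamma> 0) + t / L * (g (\<gamma> L) - g (\<gamma> 0))"
    "(L, \<gamma>) \<in> edges G" "t \<in> {0..L}"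
  have "f (\<gamma> t) = f (\<gamma> 0) + t / L * (f (\<gamma> L) - f (\<gamma> 0))" "g (\<gamma> t) = g (\<gamma> 0) + t / L * (g (\<gamma> L) - g (\<gamma> 0))"
    using bspec[OF *(1) *(3)] bspec[OF *(2) *(3)] *(4) by blast+
  then show "f (\<gamma> t) + g (\<gamma> t) = f (\<gamma> 0) + g (\<gamma> 0) + t / L * (f (\<gamma> L) + g (\<gamma> L) - (f (\<gamma> 0) + g (\<gamma> 0)))"
    by (simp add: ring_distribs)
qed

lemma edge_affine_const: "edge_affine G (\<lambda>_. c)"
  by (auto simp: edge_affine_def)

lemma edge_affine_uminus: "edge_affine G f \<Longrightarrow> edge_affine G (\<lambda>x. - f x)"
  unfolding edge_affine_def
proof (clarify)
  fix L \<gamma> t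
  assume *: "\<forall>(L, \<gamma>)\<in>edges G. \<forall>t\<in>{0..L}. f (\<gamma> t) = f (\<gamma> 0) + t / L * (f (\<gamma> L) - f (\<gamma> 0))"
    "(L, \<gamma>) \<in> edges G" "t \<in> {0..L}"
  have "f (\<gamma> t) = f (\<gamma> 0) + t / L * (f (\<gamma> L) - f (\<gamma> 0))"
    using bspec[OF *(1) *(2)] *(3) by blast
  then show "- f (\<gamma> t) = - f (\<gamma> 0) + t / L * (- f (\<gamma> L) - - f (\<gamma> 0))"
    by (simp add: ring_distribs)
qed

context metrized_graph begin

section \<open>Reciprocity, change of ground, resistance\<close>

lemma verts_subset_points: "verts G \<subseteq> points G"
  by (auto simp: points_def)

lemma voltage_grounded: "y \<in> points G \<Longrightarrow> z \<in> points G \<Longrightarrow> voltage G z z y = 0"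
  using voltage_potential[of y z] by (auto simp: is_potential_def)

text \<open>Each of the two potentials is tested against the other; the Dirichlet form is symmetric
  and both potentials vanish at \<open>p\<close>.\<close>

lemma voltage_reciprocal:
  assumes "p \<in> points G" "x \<in> points G" "y \<in> points G"
  shows "voltage G p x y = voltage G p y x"
proof -
  let ?K = "subdivide G {p, x, y}"
  interpret K: metrized_graph ?K using assms by (intro metrized_graph_subdivide) auto
  have "dirichlet ?K (\<lambda>w. voltage ?K p w y) (\<lambda>w. voltage ?K p w x) = voltage ?K p y x"
    by (simp add: K.voltage_verts)
  moreover have "dirichlet ?K (\<lambda>w. voltage ?K p w x) (\<lambda>w. voltage ?K p w y) = voltage ?K p x y"
    by (simp add: K.voltage_verts)
  ultimately have "voltage ?K p x y = voltage ?K p y x" by (simp add: dirichlet_sym)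
  then show ?thesis using assms by (simp add: voltage_subdivide)
qed

lemma voltage_source_ground: "p \<in> points G \<Longrightarrow> x \<in> points G \<Longrightarrow> voltage G p x p = 0"
  using voltage_reciprocal[of p x p] voltage_grounded[of x p] by simp

text \<open>Superposition: unit current from \<open>y\<close> to \<open>p\<close> minus unit current
  from \<open>x\<close> to \<open>p\<close> is unit current from \<open>y\<close> to
  \<open>x\<close>. The added constant makes the potential zero at \<open>x\<close>.\<close>

lemma voltage_change_ground:
  assumes "p \<in> points G" "x \<in> points G" "w \<in> points G" "y \<in> points G"
  shows "voltage G x w y = voltage G p w y - voltage G p w x + voltage G p x x - voltage G p x y"
proof -
  let ?K = "subdivide G {p, x, w, y}"
  interpret K: metrized_graph ?K using assms by (intro metrized_graph_subdivide) auto
  let ?f = "\<lambda>u. voltage ?K p u y + (- voltage ?K p u x + (voltage ?K p x x - voltage ?K p x y))"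
  have "edge_affine ?K ?f"
    by (intro edge_affine_add edge_affine_uminus edge_affine_const K.voltage_verts) auto
  moreover have "dirichlet ?K ?f g = g y - g x" for g
    by (simp only: dirichlet_add dirichlet_const_left dirichlet_uminus) (simp add: K.voltage_verts)
  ultimately have "is_potential ?K y x ?f" by (simp add: K.is_potential_verts_iff)
  then have "voltage ?K x w y = ?f w" using assms
    by (intro K.voltage_eqI) (auto simp: points_subdivide)
  then show ?thesis using assms by (simp add: voltage_subdivide)
qed

text \<open>This is the symmetry of effective resistance, as the definition grounds \<open>q\<close>
  and not \<open>p\<close>.\<close>

lemma eff_resistance_eq:
  assumes "p \<in> points G" "q \<in> points G"
  shows "eff_resistance G p q = voltage G p q q"
  using voltage_change_ground[of p q p p] assms
  by (simp add: eff_resistance_def voltage_source_ground voltage_grounded)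

text \<open>The moving ground \<open>x\<close> is traded for the fixed ground \<open>p\<close>, so
  that \<open>j_x(p, q)\<close> can be followed along an edge.\<close>

lemma voltage_ground_along:
  assumes "p \<in> points G" "q \<in> points G" "x \<in> points G"
  shows "voltage G x p q = voltage G p x x - voltage G p x q"
  using voltage_change_ground[of p x p q] assms by (simp add: voltage_grounded)

text \<open>The resistance is the energy of its own potential. If it vanished, the potential would
  be constant, and testing with the indicator of \<open>q\<close> would detect no current.\<close>

lemma resistance_pos:
  assumes "p \<in> points G" "q \<in> points G" "p \<noteq> q"
  shows "0 < voltage G p q q"
proof -
  let ?K = "subdivide G {p, q}"
  interpret K: metrized_graph ?K using assms by (intro metrized_graph_subdivide) auto
  let ?f = "\<lambda>w. voltage ?K p w q"
  have E: "dirichlet ?K ?f g = g q - g p" for g by (simp add: K.voltage_verts)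
  have f: "dirichlet ?K ?f ?f = ?f q" "?f p = 0" using E[of ?f] by (simp_all add: K.voltage_verts)
  have "?f q \<noteq> 0"
  proof
    assume "?f q = 0"
    then have "?f v = ?f p" if "v \<in> verts ?K" for v
      using K.dirichlet_zero_const[OF _ that, of ?f p] f(1) by simp
    then have "dirichlet ?K ?f (\<lambda>x. of_bool (x = q)) = dirichlet ?K (\<lambda>_. ?f p) (\<lambda>x. of_bool (x = q))"
      by (rule K.dirichlet_cong) (assumption | rule refl)+
    then show False using E[of "\<lambda>x. of_bool (x = q)"] assms(3) by (simp add: dirichlet_const_left)
  qed
  then have "0 < ?f q" using K.dirichlet_nonneg[of ?f] f(1) by simp
  then show ?thesis using assms by (simp add: voltage_subdivide)
qed

text \<open>Kirchhoff's law at a point inside an edge determines its potential from those of the two ends.\<close>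

lemma resistance_along_edge:
  assumes p: "p \<in> verts G" and e: "(L, \<gamma>) \<in> edges G" and t: "t \<in> {0..L}"
  shows "voltage G p (\<gamma> t) (\<gamma> t) =
    ((L - t) * voltage G p (\<gamma> t) (\<gamma> 0) + t * voltage G p (\<gamma> t) (\<gamma> L) + t * (L - t)) / L"
proof -
  have L: "0 < L" using length_pos[OF e] .
  consider "t = 0" | "t = L" | "t \<in> {0<..<L}" using t by force
  then show ?thesis
  proof cases
    case 3
    define x where "x = \<gamma> t"
    have pp: "p \<in> points G" "x \<in> points G" "\<gamma> 0 \<in> points G" "\<gamma> L \<in> points G"
      using p start_in_verts[OF e] end_in_verts[OF e] edge_in_points[OF e t] verts_subset_points
      by (auto simp: x_def)
    have xV: "x \<notin> verts G" using interior_notin_verts[OF e 3] by (simp add: x_def)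
    let ?K = "subdivide G {x}"
    interpret K: metrized_graph ?K using pp by (intro metrized_graph_subdivide) auto
    define f where "f w = voltage ?K p w x" for w
    define d where "d w = (of_bool (w = x) :: real)" for w :: 'a
    define T where "T L \<gamma> = (\<Sum>(a, b)\<in>consecutive (cuts (verts G \<union> {x}) L \<gamma>).
        (f (\<gamma> b) - f (\<gamma> a)) * (d (\<gamma> b) - d (\<gamma> a)) / (b - a))" for L and \<gamma> :: "real \<Rightarrow> 'a"
    have "dirichlet ?K f d = d x - d p"
      unfolding f_def using p by (intro K.voltage_verts) auto
    also have "\<dots> = 1" using p xV by (auto simp: d_def)
    finally have "1 = dirichlet ?K f d" by simp
    also have "\<dots> = (\<Sum>(L, \<gamma>)\<in>edges G. T L \<gamma>)"
      unfolding dirichlet_def T_def by (subst sum_edges_subdivide) simp_all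
    \<comment> \<open>The indicator \<open>d\<close> of \<open>x\<close> vanishes at every cut of
      the other edges, so only the edge through \<open>x\<close> contributes.\<close>
    also have "\<dots> = (\<Sum>(L', \<gamma>')\<in>{(L, \<gamma>)}. T L' \<gamma>')"
    proof (intro sum.mono_neutral_right ballI)
      fix e' assume e': "e' \<in> edges G - {(L, \<gamma>)}"
      obtain L' \<gamma>' where e'': "e' = (L', \<gamma>')" by (cases e')
      have "\<gamma>' s \<noteq> x" if s: "s \<in> {0..L'}" for s
      proof
        assume eq: "\<gamma>' s = x"
        have ed: "(L', \<gamma>') \<in> edges G" using e' e'' by auto
        have "s \<noteq> 0" "s \<noteq> L'"
          using eq xV start_in_verts[OF ed] end_in_verts[OF ed] by auto
        then have "s \<in> {0<..<L'}" using s by auto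
        from interior_eqD[OF ed e this 3] eq e' e'' show False by (auto simp: x_def)
      qed
      then have "d (\<gamma>' b) - d (\<gamma>' a) = 0" if "(a, b) \<in> consecutive (cuts (verts G \<union> {x}) L' \<gamma>')" for a b
        using consecutive_cutsD[OF that] by (simp add: d_def)
      then show "(case e' of (L, \<gamma>) \<Rightarrow> T L \<gamma>) = 0"
        unfolding e'' T_def by (auto intro!: sum.neutral)
    qed (use finite_edges e in auto)
    also have "\<dots> = T L \<gamma>" by simp
    also have "\<dots> = (f x - f (\<gamma> 0)) / t + (f x - f (\<gamma> L)) / (L - t)"
    proof -
      have "s = 0 \<or> s = L \<or> s = t" if s: "s \<in> {0..L}" "\<gamma> s \<in> verts G \<union> {x}" for s
      proof (rule ccontr)
        assume n: "\<not> ?thesis"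
        then have si: "s \<in> {0<..<L}" using s by auto
        show False using s(2) n interior_notin_verts[OF e si] interior_eqD(3)[OF e e si 3]
          by (auto simp: x_def)
      qed
      then have "cuts (verts G \<union> {x}) L \<gamma> = {0, t, L}"
        using ends_in_cuts[OF e, of "{x}"] t by (auto simp: cuts_def x_def)
      then have "consecutive (cuts (verts G \<union> {x}) L \<gamma>) = {(0, t), (t, L)}"
        using 3 by (auto simp: consecutive_def)
      moreover have "d (\<gamma> 0) = 0" "d (\<gamma> L) = 0" "d (\<gamma> t) = 1"
        using xV start_in_verts[OF e] end_in_verts[OF e] by (auto simp: d_def x_def)
      ultimately show ?thesis
        using 3 by (simp add: T_def x_def)
    qed
    finally have K1: "1 = (f x - f (\<gamma> 0)) / t + (f x - f (\<gamma> L)) / (L - t)" .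
    have t0: "t > 0" "L - t > 0" using 3 by auto
    have "t * (L - t) * 1 = t * (L - t) * ((f x - f (\<gamma> 0)) / t + (f x - f (\<gamma> L)) / (L - t))"
      using K1 by (simp only:)
    also have "\<dots> = (L - t) * (f x - f (\<gamma> 0)) + t * (f x - f (\<gamma> L))"
      using t0 by (simp add: distrib_left)
    finally have "L * f x = (L - t) * f (\<gamma> 0) + t * f (\<gamma> L) + t * (L - t)"
      by (simp add: algebra_simps)
    then have "f x = ((L - t) * f (\<gamma> 0) + t * f (\<gamma> L) + t * (L - t)) / L"
      using L by (simp add: eq_divide_eq mult.commute)
    \<comment> \<open>Reciprocity moves \<open>x\<close> from the source to the point of evaluation;
      with the source fixed at an end of the edge, the voltage is affine in
      \<open>t\<close>.\<close>
    moreover have "f x = voltage G p x x" "f (\<gamma> 0) = voltage G p x (\<gamma> 0)" "f (\<gamma> L) = voltage G p x (\<gamma> L)"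
      using pp voltage_reciprocal[of p x "\<gamma> 0"] voltage_reciprocal[of p x "\<gamma> L"]
      by (simp_all add: f_def voltage_subdivide)
    ultimately show ?thesis by (simp add: x_def)
  qed (use L in auto)
qed

section \<open>Integrals along edges\<close>

lemma continuous_on_edge_affine:
  assumes "edge_affine G f" "(L, \<gamma>) \<in> edges G"
  shows "continuous_on {0..L} (\<lambda>t. f (\<gamma> t))"
proof -
  have "continuous_on {0..L} (\<lambda>t. f (\<gamma> 0) + t / L * (f (\<gamma> L) - f (\<gamma> 0)))"
    using length_pos[OF assms(2)] by (intro continuous_intros) auto
  then show ?thesis
    by (rule continuous_on_eq) (rule edge_affineD[OF assms, symmetric], auto)
qed

text \<open>By \<open>resistance_along_edge\<close> the diagonal voltage is built from polynomials
  in \<open>t\<close> and voltages with fixed source, which are affine in \<open>t\<close>. The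
  continuity supplies integrability.\<close>

lemma continuous_on_voltage_ground:
  assumes "p \<in> verts G" "q \<in> verts G" "(L, \<gamma>) \<in> edges G"
  shows "continuous_on {0..L} (\<lambda>t. voltage G (\<gamma> t) p q)"
proof -
  have *: "continuous_on {0..L} (\<lambda>t. voltage G p (\<gamma> t) u)" if "u \<in> verts G" for u
    using continuous_on_edge_affine[OF voltage_verts(1) assms(3)] that assms(1) by blast
  have "continuous_on {0..L} (\<lambda>t. ((L - t) * voltage G p (\<gamma> t) (\<gamma> 0) + t * voltage G p (\<gamma> t) (\<gamma> L)
     + t * (L - t)) / L - voltage G p (\<gamma> t) q)"
    using length_pos[OF assms(3)] assms start_in_verts[OF assms(3)] end_in_verts[OF assms(3)]
    by (intro continuous_intros *) auto
  then show ?thesis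
  proof (rule continuous_on_eq)
    fix t assume t: "t \<in> {0..L}"
    show "((L - t) * voltage G p (\<gamma> t) (\<gamma> 0) + t * voltage G p (\<gamma> t) (\<gamma> L)
     + t * (L - t)) / L - voltage G p (\<gamma> t) q = voltage G (\<gamma> t) p q"
      using resistance_along_edge[OF assms(1,3) t] voltage_ground_along[of p q "\<gamma> t"]
        edge_in_points[OF assms(3) t] subsetD[OF verts_subset_points assms(1)]
        subsetD[OF verts_subset_points assms(2)] by simp
  qed
qed

lemma deriv_edge_affine:
  assumes "edge_affine G f" "(L, \<gamma>) \<in> edges G" "t \<in> {0<..<L}"
  shows "deriv (\<lambda>s. f (\<gamma> s)) t = (f (\<gamma> L) - f (\<gamma> 0)) / L"
proof (rule DERIV_imp_deriv)
  have "((\<lambda>s. f (\<gamma> 0) + s / L * (f (\<gamma> L) - f (\<gamma> 0))) has_field_derivative (f (\<gamma> L) - f (\<gamma> 0)) / L) (at t)"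
    using length_pos[OF assms(2)] by (auto intro!: derivative_eq_intros)
  then show "((\<lambda>s. f (\<gamma> s)) has_field_derivative (f (\<gamma> L) - f (\<gamma> 0)) / L) (at t)"
  proof (rule has_field_derivative_transform_within_open[of _ _ _ "{0<..<L}"])
    show "f (\<gamma> 0) + s / L * (f (\<gamma> L) - f (\<gamma> 0)) = f (\<gamma> s)" if "s \<in> {0<..<L}" for s
      using that by (intro edge_affineD[OF assms(1,2), symmetric]) auto
  qed (use assms(3) in auto)
qed

text \<open>Inside the edge the derivative is the constant slope. The two end parameters are
  discarded as negligible, since \<open>deriv\<close> there would depend on the meaningless values
  of \<gamma> outside the edge.\<close>

lemma A_integrand_has_integral:
  assumes "p \<in> verts G" "q \<in> verts G" "(L, \<gamma>) \<in> edges G"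
  shows "((\<lambda>t. voltage G (\<gamma> t) p q * (deriv (\<lambda>s. voltage G p (\<gamma> s) q) t)\<^sup>2) has_integral
    ((voltage G p (\<gamma> L) q - voltage G p (\<gamma> 0) q) / L)\<^sup>2 * integral {0..L} (\<lambda>t. voltage G (\<gamma> t) p q)) {0..L}"
proof (rule has_integral_spike_finite[of "{0, L}"])
  let ?m = "(voltage G p (\<gamma> L) q - voltage G p (\<gamma> 0) q) / L"
  have "(\<lambda>t. voltage G (\<gamma> t) p q) integrable_on {0..L}"
    using continuous_on_voltage_ground[OF assms] by (rule integrable_continuous_interval)
  then show "((\<lambda>t. ?m\<^sup>2 * voltage G (\<gamma> t) p q) has_integral
      ?m\<^sup>2 * integral {0..L} (\<lambda>t. voltage G (\<gamma> t) p q)) {0..L}"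
    by (intro has_integral_mult_right integrable_integral)
  fix t assume "t \<in> {0..L} - {0, L}"
  then have "deriv (\<lambda>s. voltage G p (\<gamma> s) q) t = ?m"
    using assms by (intro deriv_edge_affine[OF voltage_verts(1)]) auto
  then show "voltage G (\<gamma> t) p q * (deriv (\<lambda>s. voltage G p (\<gamma> s) q) t)\<^sup>2 = ?m\<^sup>2 * voltage G (\<gamma> t) p q"
    by simp
qed simp

text \<open>The integral over an edge is the sum of the integrals over its pieces, each translated
  back to the parameters of the edge; inside a gap the two integrands agree.\<close>

lemma A_const_subdivide:
  assumes "finite S" "S \<subseteq> points G" "p \<in> S" "q \<in> S"
  shows "A_const (subdivide G S) p q = A_const G p q"
proof -
  let ?H = "subdivide G S"
  interpret H: metrized_graph ?H using assms by (intro metrized_graph_subdivide) auto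
  have pq: "p \<in> points G" "q \<in> points G" using assms by auto
  define F where "F \<gamma> t = voltage G (\<gamma> t) p q * (deriv (\<lambda>s. voltage G p (\<gamma> s) q) t)\<^sup>2"
    for \<gamma> :: "real \<Rightarrow> 'a" and t
  define I where "I L \<gamma> = integral {0..L} (\<lambda>t. voltage ?H (\<gamma> t) p q *
     (deriv (\<lambda>s. voltage ?H p (\<gamma> s) q) t)\<^sup>2)" for L and \<gamma> :: "real \<Rightarrow> 'a"
  have "integral {0..L} (F \<gamma>) =
    (\<Sum>(a, b)\<in>consecutive (cuts (verts G \<union> S) L \<gamma>). I (b - a) (\<lambda>t. \<gamma> (a + t)))"
    if e: "(L, \<gamma>) \<in> edges G" for L \<gamma>
  proof -
    let ?C = "cuts (verts G \<union> S) L \<gamma>"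
    have "(F \<gamma> has_integral I (b - a) (\<lambda>t. \<gamma> (a + t))) {a..b}" if ab: "(a, b) \<in> consecutive ?C" for a b
    proof -
      note c = consecutive_cutsD[OF ab]
      note pc = piece_in_subdivide[OF e ab]
      have pt: "\<gamma> s \<in> points G" if "s \<in> {a..b}" for s
        using edge_in_points[OF e] that c by auto
      let ?\<Psi> = "\<lambda>t. voltage ?H (\<gamma> (a + t)) p q * (deriv (\<lambda>s. voltage ?H p (\<gamma> (a + s)) q) t)\<^sup>2"
      have "p \<in> verts ?H" "q \<in> verts ?H" using assms(3,4) by auto
      from H.A_integrand_has_integral[OF this pc] have "?\<Psi> integrable_on {0..b - a}"
        by (rule has_integral_integrable)
      then have "(?\<Psi> has_integral I (b - a) (\<lambda>t. \<gamma> (a + t))) (cbox 0 (b - a))"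
        unfolding I_def cbox_interval by (rule integrable_integral)
      from has_integral_affinity'[OF this, of 1 "-a"]
      have "((\<lambda>t. ?\<Psi> (t - a)) has_integral I (b - a) (\<lambda>t. \<gamma> (a + t))) {a..b}"
        by (simp add: cbox_interval)
      then show ?thesis
      proof (rule has_integral_spike_finite[of "{a, b}", rotated 2])
        fix t assume t: "t \<in> {a..b} - {a, b}"
        have "deriv (\<lambda>s. voltage ?H p (\<gamma> (a + s)) q) (t - a) =
            (voltage ?H p (\<gamma> (a + (b - a))) q - voltage ?H p (\<gamma> (a + 0)) q) / (b - a)" (is "_ = ?m")
          using t assms(3,4) by (intro H.deriv_edge_affine[OF H.voltage_verts(1) pc]) auto
        moreover have "((\<lambda>s. voltage ?H p (\<gamma> (a + (s - a))) q) has_field_derivative ?m) (at t)"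
        proof -
          have "voltage ?H p (\<gamma> (a + (s - a))) q = voltage ?H p (\<gamma> (a + 0)) q + (s - a) * ?m"
            if "s \<in> {a<..<b}" for s
            using edge_affineD[OF H.voltage_verts(1) pc, of q p "s - a"] assms(3,4) that by simp
          moreover have "((\<lambda>s. voltage ?H p (\<gamma> (a + 0)) q + (s - a) * ?m) has_field_derivative ?m) (at t)"
            using c(2) by (auto intro!: derivative_eq_intros)
          ultimately show ?thesis using t
            by (elim has_field_derivative_transform_within_open[of _ _ _ "{a<..<b}"]) auto
        qed
        \<comment> \<open>The two voltages are known to agree only at points of the graph, so the
          derivative is transferred on the open gap.\<close>
        then have "((\<lambda>s. voltage G p (\<gamma> s) q) has_field_derivative ?m) (at t)"
          by (rule has_field_derivative_transform_within_open[of _ _ _ "{a<..<b}"])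
             (use t pt pq assms in \<open>auto simp: voltage_subdivide\<close>)
        ultimately have "deriv (\<lambda>s. voltage G p (\<gamma> s) q) t =
            deriv (\<lambda>s. voltage ?H p (\<gamma> (a + s)) q) (t - a)"
          by (simp add: DERIV_imp_deriv)
        then show "F \<gamma> t = ?\<Psi> (t - a)"
          using t pt[of t] pq assms by (simp add: F_def voltage_subdivide)
      qed simp
    qed
    then have "(F \<gamma> has_integral (\<Sum>(a, b)\<in>consecutive ?C. I (b - a) (\<lambda>t. \<gamma> (a + t)))) {Min ?C..Max ?C}"
      using ends_in_cuts(1)[OF e, of S] by (intro consecutive_integral finite_cuts[OF e assms(1)]) auto
    then show ?thesis
      by (simp add: Min_Max_cuts[OF e assms(1)] integral_unique)
  qed
  then have "(\<Sum>(L, \<gamma>)\<in>edges G. integral {0..L} (F \<gamma>)) = (\<Sum>(L, \<gamma>)\<in>edges ?H. I L \<gamma>)"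
    unfolding sum_edges_subdivide[OF assms(1)] by (intro sum.cong) auto
  then show ?thesis by (simp add: A_const_def F_def[abs_def] I_def)
qed

text \<open>The test function is an antiderivative of \<open>s (r - s)\<close> composed with the potential, so the
  left-hand side is the Dirichlet pairing of the potential with it.\<close>

lemma sum_slope_integral:
  assumes "p \<in> verts G" "q \<in> verts G"
  defines "f \<equiv> \<lambda>x. voltage G p x q" and "r \<equiv> voltage G p q q"
  shows "(\<Sum>(L, \<gamma>)\<in>edges G. ((f (\<gamma> L) - f (\<gamma> 0)) / L)\<^sup>2 *
    integral {0..L} (\<lambda>t. f (\<gamma> t) * (r - f (\<gamma> t)))) = r ^ 3 / 6"
proof -
  define P where "P s = r * s\<^sup>2 / 2 - s ^ 3 / 3" for s :: real
  have aff: "edge_affine G f" using voltage_verts(1)[OF assms(2,1)] by (simp add: f_def)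
  have "((f (\<gamma> L) - f (\<gamma> 0)) / L)\<^sup>2 * integral {0..L} (\<lambda>t. f (\<gamma> t) * (r - f (\<gamma> t))) =
     (f (\<gamma> L) - f (\<gamma> 0)) * (P (f (\<gamma> L)) - P (f (\<gamma> 0))) / L" if e: "(L, \<gamma>) \<in> edges G" for L \<gamma>
  proof -
    define m u where "m = (f (\<gamma> L) - f (\<gamma> 0)) / L" and "u = f (\<gamma> 0)"
    have L: "0 < L" using length_pos[OF e] .
    have g: "f (\<gamma> t) = u + t * m" if "t \<in> {0..L}" for t
      using edge_affineD[OF aff e, of t] that by (simp add: m_def u_def)
    have "((\<lambda>t. m * ((u + t * m) * (r - (u + t * m)))) has_integral P (u + L * m) - P (u + 0 * m)) {0..L}"
    proof (rule fundamental_theorem_of_calculus)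
      show "0 \<le> L" using L by simp
      fix t
      have "((\<lambda>t. P (u + t * m)) has_real_derivative m * ((u + t * m) * (r - (u + t * m)))) (at t within {0..L})"
        unfolding P_def by (rule derivative_eq_intros refl | simp)+ (simp add: algebra_simps power2_eq_square)
      then show "((\<lambda>t. P (u + t * m)) has_vector_derivative m * ((u + t * m) * (r - (u + t * m)))) (at t within {0..L})"
        by (simp only: has_real_derivative_iff_has_vector_derivative)
    qed
    then have "m * integral {0..L} (\<lambda>t. (u + t * m) * (r - (u + t * m))) = P (u + L * m) - P (u + 0 * m)"
      by (metis integral_mult_right integral_unique)
    also have "integral {0..L} (\<lambda>t. (u + t * m) * (r - (u + t * m))) =
        integral {0..L} (\<lambda>t. f (\<gamma> t) * (r - f (\<gamma> t)))"
      by (intro integral_cong) (simp add: g)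
    also have "P (u + L * m) - P (u + 0 * m) = P (f (\<gamma> L)) - P (f (\<gamma> 0))"
      using g[of L] g[of 0] L by simp
    finally have "m * (m * integral {0..L} (\<lambda>t. f (\<gamma> t) * (r - f (\<gamma> t)))) =
        m * (P (f (\<gamma> L)) - P (f (\<gamma> 0)))"
      by (simp only:)
    then show ?thesis by (simp add: power2_eq_square m_def)
  qed
  then have "(\<Sum>(L, \<gamma>)\<in>edges G. ((f (\<gamma> L) - f (\<gamma> 0)) / L)\<^sup>2 *
    integral {0..L} (\<lambda>t. f (\<gamma> t) * (r - f (\<gamma> t)))) = dirichlet G f (\<lambda>x. P (f x))"
    unfolding dirichlet_def by (intro sum.cong) auto
  also have "\<dots> = P (f q) - P (f p)"
    unfolding f_def using voltage_verts(2)[OF assms(2,1)] by simp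
  also have "\<dots> = r ^ 3 / 6"
    using voltage_verts(3)[OF assms(2,1)]
    by (simp add: P_def f_def r_def power2_eq_square power3_eq_cube)
  finally show ?thesis .
qed

end

section \<open>Union along two points\<close>

text \<open>The plain union, meant for graphs whose common points are already vertices of
  both.\<close>

definition glue :: "'a mgraph \<Rightarrow> 'a mgraph \<Rightarrow> 'a mgraph" where
  "glue A B = \<lparr>verts = verts A \<union> verts B, edges = edges A \<union> edges B\<rparr>"

lemma glue_simps [simp]: "verts (glue A B) = verts A \<union> verts B" "edges (glue A B) = edges A \<union> edges B"
  by (simp_all add: glue_def)

lemma glue_commute: "glue A B = glue B A"
  by (simp add: glue_def Un_commute)

lemma points_glue: "points (glue A B) = points A \<union> points B"
  by (auto simp: points_def)

lemma mg_union_eq_glue: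
  assumes "points A \<inter> points B = {p, q}"
  shows "mg_union A B = glue (subdivide A {p, q}) (subdivide B {p, q})"
  by (simp add: mg_union_def glue_def assms Let_def)

locale glued_graphs = A: metrized_graph A + B: metrized_graph B
  for A B :: "'a mgraph" and p q :: 'a +
  assumes distinct: "p \<noteq> q"
    and common_points: "points A \<inter> points B = {p, q}"
    and p_verts: "p \<in> verts A" "p \<in> verts B"
    and q_verts: "q \<in> verts A" "q \<in> verts B"
begin

text \<open>The results below that treat the side of \<open>A\<close> transfer to \<open>B\<close>
  by this symmetry.\<close>

lemma glued_graphs_swap: "glued_graphs B A p q"
  by unfold_locales (use distinct common_points p_verts q_verts in auto)

text \<open>The common points are vertices of \<open>A\<close>, and edge interiors avoid
  vertices.\<close>

lemma interior_A_disjoint: "e \<in> edges A \<Longrightarrow> edge_interior e \<inter> points B = {}"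
proof -
  assume e: "e \<in> edges A"
  have "edge_interior e \<inter> points B \<subseteq> points A \<inter> points B" using e by (auto simp: points_def)
  also have "\<dots> \<subseteq> verts A" unfolding common_points using p_verts q_verts by auto
  finally show ?thesis using A.interior_verts[OF e] by auto
qed

lemma interior_B_disjoint: "e \<in> edges B \<Longrightarrow> edge_interior e \<inter> points A = {}"
  using glued_graphs.interior_A_disjoint[OF glued_graphs_swap] .

lemma common_in_points: "p \<in> points A" "q \<in> points A" "p \<in> points B" "q \<in> points B"
  using common_points by auto

lemma edges_disjoint: "edges A \<inter> edges B = {}"
proof (rule ccontr)
  assume "edges A \<inter> edges B \<noteq> {}"
  then obtain L \<gamma> where e: "(L, \<gamma>) \<in> edges A" "(L, \<gamma>) \<in> edges B" by auto
  have "\<gamma> (L / 2) \<in> edge_interior (L, \<gamma>)"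
    using A.length_pos[OF e(1)] by (auto simp: edge_interior_def)
  then show False using interior_A_disjoint[OF e(1)] e(2) by (auto simp: points_def)
qed

lemma metrized_graph_glue: "metrized_graph (glue A B)"
proof
  show "finite (verts (glue A B))" "finite (edges (glue A B))" "verts (glue A B) \<noteq> {}"
    using A.finite_verts B.finite_verts A.finite_edges B.finite_edges A.verts_nonempty by auto
next
  fix L \<gamma> assume "(L, \<gamma>) \<in> edges (glue A B)"
  then show "0 < L" "\<gamma> 0 \<in> verts (glue A B)" "\<gamma> L \<in> verts (glue A B)" "inj_on \<gamma> {0<..<L}"
    using A.length_pos B.length_pos A.start_in_verts B.start_in_verts A.end_in_verts B.end_in_verts
      A.edge_inj B.edge_inj by auto
next
  fix e assume "e \<in> edges (glue A B)"
  then show "edge_interior e \<inter> verts (glue A B) = {}"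
    using A.interior_verts[of e] B.interior_verts[of e] interior_A_disjoint[of e] interior_B_disjoint[of e]
      A.verts_subset_points B.verts_subset_points unfolding glue_simps by (elim UnE) blast+
next
  fix e e' assume "e \<in> edges (glue A B)" "e' \<in> edges (glue A B)" "e \<noteq> e'"
  then show "edge_interior e \<inter> edge_interior e' = {}"
    using A.interior_disjoint[of e e'] B.interior_disjoint[of e e'] interior_A_disjoint[of e]
      interior_B_disjoint[of e]
    by (auto simp: points_def)
next
  let ?R = "\<lambda>G. edge_ends G \<union> (edge_ends G)\<inverse>"
  have "edge_ends (glue A B) = edge_ends A \<union> edge_ends B" by (auto simp: edge_ends_def)
  then have mono: "(?R A)\<^sup>* \<subseteq> (?R (glue A B))\<^sup>*" "(?R B)\<^sup>* \<subseteq> (?R (glue A B))\<^sup>*"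
    by (intro rtrancl_mono; auto)+
  \<comment> \<open>Every vertex of either part is connected to \<open>p\<close>, which belongs to
    both.\<close>
  have "(u, p) \<in> (?R (glue A B))\<^sup>*" "(p, u) \<in> (?R (glue A B))\<^sup>*" if "u \<in> verts (glue A B)" for u
    using that A.connected[of u p] A.connected[of p u] B.connected[of u p] B.connected[of p u] p_verts mono by auto
  then show "(u, v) \<in> (?R (glue A B))\<^sup>*" if "u \<in> verts (glue A B)" "v \<in> verts (glue A B)" for u v
    using that by (meson rtrancl_trans)
qed

lemma dirichlet_glue: "dirichlet (glue A B) f g = dirichlet A f g + dirichlet B f g"
  unfolding dirichlet_def
  by (simp add: sum.union_disjoint[OF A.finite_edges B.finite_edges edges_disjoint])

text \<open>A point of \<open>A\<close> that also lies on \<open>B\<close> is \<open>p\<close> or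
  \<open>q\<close>, already a vertex, so the edges of \<open>B\<close> remain uncut.\<close>

lemma subdivide_glue:
  assumes "x \<in> points A"
  shows "subdivide (glue A B) {x} = glue (subdivide A {x}) B"
proof -
  have VA: "w \<in> verts A" if "w \<in> points A" "w \<in> points B" for w
    using that common_points p_verts q_verts by auto
  have VB: "w \<in> verts B" if "w \<in> points A" "w \<in> points B" for w
    using that common_points p_verts q_verts by auto
  have cA: "cuts (verts A \<union> verts B \<union> {x}) L \<gamma> = cuts (verts A \<union> {x}) L \<gamma>" if "(L, \<gamma>) \<in> edges A" for L \<gamma>
    unfolding cuts_def
    using VA[OF A.edge_in_points[OF that] subsetD[OF B.verts_subset_points]] by auto
  have cB: "cuts (verts A \<union> verts B \<union> {x}) L \<gamma> = cuts (verts B \<union> {}) L \<gamma>" if "(L, \<gamma>) \<in> edges B" for L \<gamma>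
    unfolding cuts_def
    using VB[OF subsetD[OF A.verts_subset_points] B.edge_in_points[OF that]]
      VB[OF assms] B.edge_in_points[OF that] by auto
  have "edges (subdivide (glue A B) {x}) = edges (subdivide A {x}) \<union> edges (subdivide B {})"
    unfolding edges_subdivide glue_simps using cA cB
    by (intro set_eqI) (simp only: Un_iff mem_Collect_eq, metis)
  then have "edges (subdivide (glue A B) {x}) = edges (glue (subdivide A {x}) B)"
    by (simp add: B.subdivide_verts)
  moreover have "verts (subdivide (glue A B) {x}) = verts (glue (subdivide A {x}) B)" by auto
  ultimately show ?thesis by (simp add: subdivide_def glue_def)
qed

lemma glued_graphs_subdivide:
  assumes "x \<in> points A"
  shows "glued_graphs (subdivide A {x}) B p q"
proof -
  interpret K: metrized_graph "subdivide A {x}" using assms by (intro A.metrized_graph_subdivide) auto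
  show ?thesis
    by unfold_locales (use distinct common_points p_verts q_verts assms in \<open>auto simp: A.points_subdivide\<close>)
qed

section \<open>Potentials of the glued graph\<close>

text \<open>The potential of the glued graph is tested against the function that is the potential of \<open>A\<close>
  with source \<open>x\<close> on \<open>A\<close> and a multiple of the potential with source \<open>q\<close> on \<open>B\<close>; the factor makes the
  two agree at \<open>q\<close>.\<close>

lemma voltage_glue_test:
  assumes "s \<in> verts A" "x \<in> verts A"
  shows "voltage (glue A B) p x s + voltage A p x q / voltage B p q q * voltage (glue A B) p q s
    = voltage A p s x"
proof -
  interpret U: metrized_graph "glue A B" by (rule metrized_graph_glue)
  let ?H = "\<lambda>w. voltage (glue A B) p w s" and ?h = "\<lambda>w. voltage A p w x" and ?f = "\<lambda>w. voltage B p w q"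
  let ?c = "voltage A p x q / voltage B p q q"
  define g where "g w = (if w \<in> verts A then ?h w else ?c * ?f w)" for w
  have r: "voltage B p q q > 0"
    using B.resistance_pos[of p q] p_verts q_verts distinct B.verts_subset_points by auto
  have hq: "?h q = voltage A p x q"
    using A.voltage_reciprocal[of p q x] p_verts q_verts assms A.verts_subset_points by auto
  have gB: "g w = ?c * ?f w" if "w \<in> verts B" for w
  proof (cases "w \<in> verts A")
    case True
    then have "w = p \<or> w = q" using that common_points A.verts_subset_points B.verts_subset_points by blast
    then show ?thesis
      using True r hq A.voltage_verts(3)[OF assms(2) p_verts(1)] B.voltage_verts(3)[OF q_verts(2) p_verts(2)]
      by (auto simp: g_def)
  qed (simp add: g_def)
  have Hp: "?H p = 0" using U.voltage_verts(3)[of s p] assms p_verts by auto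
  have "dirichlet (glue A B) ?H g = g s - g p" using assms p_verts by (intro U.voltage_verts) auto
  also have "\<dots> = voltage A p s x"
    using assms p_verts A.voltage_verts(3)[OF assms(2) p_verts(1)] by (simp add: g_def)
  finally have "voltage A p s x = dirichlet A ?H g + dirichlet B ?H g" by (simp add: dirichlet_glue)
  also have "dirichlet A ?H g = dirichlet A ?H ?h" by (rule A.dirichlet_cong) (auto simp: g_def)
  also have "\<dots> = ?H x"
    using A.voltage_verts(2)[OF assms(2) p_verts(1), of ?H] Hp by (simp add: dirichlet_sym)
  also have "dirichlet B ?H g = dirichlet B ?H (\<lambda>w. ?c * ?f w)" by (rule B.dirichlet_cong) (auto simp: gB)
  also have "\<dots> = ?c * ?H q"
    using B.voltage_verts(2)[OF q_verts(2) p_verts(2), of ?H] Hp dirichlet_sym[of B ?H ?f]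
    by (simp only: dirichlet_scale_right) simp
  finally show ?thesis by simp
qed

text \<open>Three instances of \<open>voltage_glue_test\<close>, with source and evaluation point
  taken from \<open>q\<close> and \<open>x\<close>, form a triangular linear system for
  \<open>R\<close>, \<open>F\<close> and \<open>P\<close>. The second claim then follows by moving
  the ground to \<open>p\<close> in both graphs.\<close>

lemma voltage_glue_vertex:
  assumes "x \<in> verts A"
  defines "r1 \<equiv> voltage A p q q" and "r2 \<equiv> voltage B p q q" and "f \<equiv> voltage A p x q"
  shows "voltage (glue A B) p x q = r2 / (r1 + r2) * f"
    and "voltage (glue A B) x p q = voltage A x p q + f * (r1 - f) / (r1 + r2)"
proof -
  interpret U: metrized_graph "glue A B" by (rule metrized_graph_glue)
  have pts: "p \<in> points A" "q \<in> points A" "x \<in> points A" "p \<in> points B" "q \<in> points B"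
    "p \<in> points (glue A B)" "q \<in> points (glue A B)" "x \<in> points (glue A B)"
    using assms(1) p_verts q_verts A.verts_subset_points B.verts_subset_points by (auto simp: points_glue)
  have pos: "r1 > 0" "r2 > 0"
    unfolding r1_def r2_def using A.resistance_pos B.resistance_pos distinct pts by auto
  define F where "F = voltage (glue A B) p x q"
  define R where "R = voltage (glue A B) p q q"
  define P where "P = voltage (glue A B) p x x"
  have sym: "voltage A p q x = f" "voltage (glue A B) p q x = F"
    unfolding f_def F_def using A.voltage_reciprocal U.voltage_reciprocal pts by auto
  have 1: "R + r1 / r2 * R = r1"
    using voltage_glue_test[OF q_verts(1) q_verts(1)] by (simp add: R_def r1_def r2_def)
  have 2: "F + f / r2 * R = f"
    using voltage_glue_test[OF q_verts(1) assms(1)] sym by (simp add: F_def R_def r2_def f_def)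
  have 3: "P + f / r2 * F = voltage A p x x"
    using voltage_glue_test[OF assms(1) assms(1)] sym by (simp add: P_def r2_def f_def)
  \<comment> \<open>The law of parallel resistors.\<close>
  have R: "R = r1 * r2 / (r1 + r2)" using 1 pos by (simp add: field_simps)
  have F: "F = r2 / (r1 + r2) * f" using 2 pos unfolding R by (simp add: field_simps)
  then show "voltage (glue A B) p x q = r2 / (r1 + r2) * f" by (simp add: F_def)
  have P: "P = voltage A p x x - f\<^sup>2 / (r1 + r2)"
    using 3 pos unfolding F by (simp add: power2_eq_square)
  have "voltage (glue A B) x p q = P - F"
    using U.voltage_ground_along[of p q x] pts by (simp add: P_def F_def)
  moreover have "voltage A x p q = voltage A p x x - f"
    using A.voltage_ground_along[of p q x] pts by (simp add: f_def)
  moreover have "f * (r1 - f) / (r1 + r2) = f - r2 / (r1 + r2) * f - f\<^sup>2 / (r1 + r2)"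
  proof -
    have "f - r2 / (r1 + r2) * f - f\<^sup>2 / (r1 + r2) = ((r1 + r2) * f - r2 * f - f\<^sup>2) / (r1 + r2)"
      using pos by (simp add: diff_divide_distrib)
    also have "(r1 + r2) * f - r2 * f - f\<^sup>2 = f * (r1 - f)" by algebra
    finally show ?thesis by simp
  qed
  ultimately show "voltage (glue A B) x p q = voltage A x p q + f * (r1 - f) / (r1 + r2)"
    by (simp only: P F)
qed

text \<open>Cutting \<open>A\<close> at \<open>x\<close> makes \<open>x\<close> a vertex, commutes
  with gluing and preserves all voltages involved.\<close>

lemma voltage_glue:
  assumes "x \<in> points A"
  defines "r1 \<equiv> voltage A p q q" and "r2 \<equiv> voltage B p q q" and "f \<equiv> voltage A p x q"
  shows "voltage (glue A B) p x q = r2 / (r1 + r2) * f"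
    and "voltage (glue A B) x p q = voltage A x p q + f * (r1 - f) / (r1 + r2)"
proof -
  interpret U: metrized_graph "glue A B" by (rule metrized_graph_glue)
  interpret K: glued_graphs "subdivide A {x}" B p q using assms(1) by (rule glued_graphs_subdivide)
  have x: "x \<in> verts (subdivide A {x})" by simp
  have pts: "p \<in> points A" "q \<in> points A" "p \<in> points (glue A B)" "q \<in> points (glue A B)" "x \<in> points (glue A B)"
    using assms(1) p_verts q_verts A.verts_subset_points by (auto simp: points_glue)
  have g: "glue (subdivide A {x}) B = subdivide (glue A B) {x}" using subdivide_glue[OF assms(1)] by simp
  show "voltage (glue A B) p x q = r2 / (r1 + r2) * f"
    "voltage (glue A B) x p q = voltage A x p q + f * (r1 - f) / (r1 + r2)"
    using K.voltage_glue_vertex[OF x] pts assms(1) unfolding g r1_def r2_def f_def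
    by (simp_all add: A.voltage_subdivide U.voltage_subdivide)
qed

section \<open>The constant \<open>A_const\<close> of the glued graph\<close>

text \<open>On \<open>A\<close> every slope is scaled by \<open>r2 / (r1 + r2)\<close>. The
  correction to \<open>j_x(p, q)\<close> has numerator \<open>f * (r1 - f)\<close>, whose integral
  against the squared unscaled slopes is evaluated by \<open>sum_slope_integral\<close>.\<close>

lemma A_const_glue_side:
  defines "r1 \<equiv> voltage A p q q" and "r2 \<equiv> voltage B p q q" and "U \<equiv> glue A B"
  shows "(\<Sum>(L, \<gamma>)\<in>edges A. integral {0..L}
      (\<lambda>t. voltage U (\<gamma> t) p q * (deriv (\<lambda>s. voltage U p (\<gamma> s) q) t)\<^sup>2)) =
    (r2 / (r1 + r2))\<^sup>2 * (A_const A p q + r1 ^ 3 / (6 * (r1 + r2)))"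
proof -
  interpret U: metrized_graph U unfolding U_def by (rule metrized_graph_glue)
  define f where "f x = voltage A p x q" for x
  define m where "m L \<gamma> = (f (\<gamma> L) - f (\<gamma> 0)) / L" for L and \<gamma> :: "real \<Rightarrow> 'a"
  define c where "c = r2 / (r1 + r2)"
  have aff: "edge_affine A f" using A.voltage_verts(1)[OF q_verts(1) p_verts(1)] by (simp add: f_def[abs_def])
  have A: "A_const A p q = (\<Sum>(L, \<gamma>)\<in>edges A. (m L \<gamma>)\<^sup>2 * integral {0..L} (\<lambda>t. voltage A (\<gamma> t) p q))"
    unfolding A_const_def m_def f_def
    using A.A_integrand_has_integral[OF p_verts(1) q_verts(1)] by (intro sum.cong) (auto dest: integral_unique)
  have "integral {0..L} (\<lambda>t. voltage U (\<gamma> t) p q * (deriv (\<lambda>s. voltage U p (\<gamma> s) q) t)\<^sup>2) =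
      c\<^sup>2 * ((m L \<gamma>)\<^sup>2 * integral {0..L} (\<lambda>t. voltage A (\<gamma> t) p q)) +
      c\<^sup>2 / (r1 + r2) * ((m L \<gamma>)\<^sup>2 * integral {0..L} (\<lambda>t. f (\<gamma> t) * (r1 - f (\<gamma> t))))"
    if e: "(L, \<gamma>) \<in> edges A" for L \<gamma>
  proof -
    have eU: "(L, \<gamma>) \<in> edges U" using e by (simp add: U_def)
    have V: "voltage U p (\<gamma> t) q = c * f (\<gamma> t)"
      "voltage U (\<gamma> t) p q = voltage A (\<gamma> t) p q + (f (\<gamma> t) * (r1 - f (\<gamma> t))) / (r1 + r2)"
      if "t \<in> {0..L}" for t
      using voltage_glue[OF A.edge_in_points[OF e that]] by (simp_all add: U_def c_def r1_def r2_def f_def)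
    have L: "0 \<in> {0..L}" "L \<in> {0..L}" using A.length_pos[OF e] by auto
    have "p \<in> verts U" "q \<in> verts U" using p_verts q_verts by (auto simp: U_def)
    from integral_unique[OF U.A_integrand_has_integral[OF this eU]]
    have "integral {0..L} (\<lambda>t. voltage U (\<gamma> t) p q * (deriv (\<lambda>s. voltage U p (\<gamma> s) q) t)\<^sup>2) =
      (c * m L \<gamma>)\<^sup>2 * integral {0..L} (\<lambda>t. voltage U (\<gamma> t) p q)"
      using V(1)[OF L(1)] V(1)[OF L(2)] by (simp add: m_def right_diff_distrib[symmetric])
    also have "integral {0..L} (\<lambda>t. voltage U (\<gamma> t) p q) =
      integral {0..L} (\<lambda>t. voltage A (\<gamma> t) p q + (f (\<gamma> t) * (r1 - f (\<gamma> t))) / (r1 + r2))"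
      by (intro integral_cong V)
    also have "\<dots> = integral {0..L} (\<lambda>t. voltage A (\<gamma> t) p q) +
       integral {0..L} (\<lambda>t. (f (\<gamma> t) * (r1 - f (\<gamma> t))) / (r1 + r2))"
    proof (intro integral_add integrable_continuous_interval)
      show "continuous_on {0..L} (\<lambda>t. voltage A (\<gamma> t) p q)"
        by (rule A.continuous_on_voltage_ground[OF p_verts(1) q_verts(1) e])
      show "continuous_on {0..L} (\<lambda>t. f (\<gamma> t) * (r1 - f (\<gamma> t)) / (r1 + r2))"
        unfolding divide_inverse by (intro continuous_intros A.continuous_on_edge_affine[OF aff e])
    qed
    also have "integral {0..L} (\<lambda>t. (f (\<gamma> t) * (r1 - f (\<gamma> t))) / (r1 + r2)) =
       integral {0..L} (\<lambda>t. f (\<gamma> t) * (r1 - f (\<gamma> t))) / (r1 + r2)"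
      by (rule integral_divide)
    finally show ?thesis by (simp add: power_mult_distrib distrib_left)
  qed
  then have "(\<Sum>(L, \<gamma>)\<in>edges A. integral {0..L}
      (\<lambda>t. voltage U (\<gamma> t) p q * (deriv (\<lambda>s. voltage U p (\<gamma> s) q) t)\<^sup>2)) =
    (\<Sum>(L, \<gamma>)\<in>edges A. c\<^sup>2 * ((m L \<gamma>)\<^sup>2 * integral {0..L} (\<lambda>t. voltage A (\<gamma> t) p q)) +
      c\<^sup>2 / (r1 + r2) * ((m L \<gamma>)\<^sup>2 * integral {0..L} (\<lambda>t. f (\<gamma> t) * (r1 - f (\<gamma> t)))))"
    by (intro sum.cong) auto
  also have "\<dots> = c\<^sup>2 * A_const A p q + c\<^sup>2 / (r1 + r2) *
    (\<Sum>(L, \<gamma>)\<in>edges A. (m L \<gamma>)\<^sup>2 * integral {0..L} (\<lambda>t. f (\<gamma> t) * (r1 - f (\<gamma> t))))"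
    unfolding A by (simp add: case_prod_unfold sum.distrib sum_distrib_left)
  also have "\<dots> = c\<^sup>2 * A_const A p q + c\<^sup>2 / (r1 + r2) * (r1 ^ 3 / 6)"
    using A.sum_slope_integral[OF p_verts(1) q_verts(1)] unfolding m_def f_def r1_def by (simp only:)
  finally show ?thesis by (simp add: c_def distrib_left)
qed

text \<open>The sum over edges splits into the two sides, the second being the first with
  \<open>A\<close> and \<open>B\<close> exchanged; the rest is algebra.\<close>

lemma A_const_glue:
  defines "r1 \<equiv> voltage A p q q" and "r2 \<equiv> voltage B p q q"
  shows "A_const (glue A B) p q =
    (r2\<^sup>2 * A_const A p q + r1\<^sup>2 * A_const B p q) / (r1 + r2)\<^sup>2 + 1 / 6 * (r1 * r2 / (r1 + r2))\<^sup>2"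
proof -
  have pos: "r1 > 0" "r2 > 0"
    unfolding r1_def r2_def
    using A.resistance_pos[of p q] B.resistance_pos[of p q] distinct common_in_points by auto
  have "A_const (glue A B) p q =
    (r2 / (r1 + r2))\<^sup>2 * (A_const A p q + r1 ^ 3 / (6 * (r1 + r2))) +
    (r1 / (r2 + r1))\<^sup>2 * (A_const B p q + r2 ^ 3 / (6 * (r2 + r1)))"
    unfolding r1_def r2_def A_const_glue_side[symmetric]
      glued_graphs.A_const_glue_side[OF glued_graphs_swap, symmetric] glue_commute[of B A] A_const_def[of "glue A B"]
    by (simp add: sum.union_disjoint[OF A.finite_edges B.finite_edges edges_disjoint])
  also have "\<dots> = (r2\<^sup>2 * A_const A p q + r1\<^sup>2 * A_const B p q) / (r1 + r2)\<^sup>2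
     + (r2\<^sup>2 * r1 ^ 3 + r1\<^sup>2 * r2 ^ 3) / (6 * (r1 + r2) * (r1 + r2)\<^sup>2)"
  proof -
    have "(x / R)\<^sup>2 * (a + y / (6 * R)) = x\<^sup>2 * a / R\<^sup>2 + x\<^sup>2 * y / (6 * R * R\<^sup>2)" for x R a y :: real
      by (simp add: power_divide distrib_left add_divide_distrib mult_ac)
    then show ?thesis by (simp only: add.commute[of r2 r1] add_divide_distrib)
  qed
  \<comment> \<open>The sum of the two cubic corrections contains the factor \<open>r1 + r2\<close>,
    which cancels and leaves the square of the parallel resistance.\<close>
  also have "(r2\<^sup>2 * r1 ^ 3 + r1\<^sup>2 * r2 ^ 3) = (r1 + r2) * (r1 * r2)\<^sup>2" by algebra
  also have "(r1 + r2) * (r1 * r2)\<^sup>2 / (6 * (r1 + r2) * (r1 + r2)\<^sup>2) = 1 / 6 * (r1 * r2 / (r1 + r2))\<^sup>2"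
  proof -
    have "R * x\<^sup>2 / (6 * R * R\<^sup>2) = 1 / 6 * (x / R)\<^sup>2" if "R > 0" for R x :: real
      using that by (simp add: power_divide)
    then show ?thesis using pos by (simp only: add_pos_pos)
  qed
  finally show ?thesis .
qed

end

theorem theorem8p1:
  fixes G1 G2 :: "'a mgraph" and p q :: 'a
  assumes "metrized_graph G1" and "metrized_graph G2"
    and "p \<noteq> q" and "points G1 \<inter> points G2 = {p, q}"
  shows "A_const (mg_union G1 G2) p q =
    ((eff_resistance G2 p q)\<^sup>2 * A_const G1 p q + (eff_resistance G1 p q)\<^sup>2 * A_const G2 p q)
      / (eff_resistance G1 p q + eff_resistance G2 p q)\<^sup>2
    + 1 / 6 * (eff_resistance G1 p q * eff_resistance G2 p q
        / (eff_resistance G1 p q + eff_resistance G2 p q))\<^sup>2"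
proof -
  interpret G1: metrized_graph G1 by fact
  interpret G2: metrized_graph G2 by fact
  have pts: "{p, q} \<subseteq> points G1" "{p, q} \<subseteq> points G2" using assms(4) by auto
  \<comment> \<open>The points \<open>p\<close> and \<open>q\<close> may lie inside edges. Cutting
    there makes them vertices and changes neither \<open>A_const\<close> nor the
    resistances.\<close>
  interpret H1: metrized_graph "subdivide G1 {p, q}" using pts by (intro G1.metrized_graph_subdivide) auto
  interpret H2: metrized_graph "subdivide G2 {p, q}" using pts by (intro G2.metrized_graph_subdivide) auto
  interpret H: glued_graphs "subdivide G1 {p, q}" "subdivide G2 {p, q}" p q
    by unfold_locales (use assms pts in \<open>auto simp: G1.points_subdivide G2.points_subdivide\<close>)
  show ?thesis
    using H.A_const_glue pts
    by (simp add: mg_union_eq_glue[OF assms(4)] G1.eff_resistance_eq G2.eff_resistance_eq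
      G1.voltage_subdivide G2.voltage_subdivide G1.A_const_subdivide G2.A_const_subdivide)
qed

end
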